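(* The functions $\sigma_{\mathrm{SO}(2n)}$ and $\sigma_{\mathrm U(n)}$ define twisted equivariant elliptic Euler classes as the global sections $$\mathrm{Eu}_{\mathrm{Spin}(2n)}:=\beta^{-n}\cdot\sigma_{\mathrm{SO}(2n)}\in\Gamma\big(\mathrm{Bun}_{\mathrm{Spin}(2n)}(\mathcal E);\widehat{\mathrm{Ell}}{}^{2n}_{\mathrm{Spin}(2n)}(\mathrm{pt})\otimes\mathcal L_{\mathrm{Spin}(2n)}\big),$$ $$\mathrm{Eu}_{\mathrm U(n)}:=\beta^{-n}\cdot\sigma_{\mathrm U(n)}\in\Gamma\big(\mathrm{Bun}_{\mathrm U(n)}(\mathcal E);\widehat{\mathrm{Ell}}{}^{2n}_{\mathrm U(n)}(\mathrm{pt})\otimes\mathcal L_{\mathrm U(n)}\big)$$ of equivariant elliptic cocycles twisted by the holomorphic line bundles $\mathcal L_G$, $G=\mathrm{Spin}(2n),\mathrm U(n)$.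
   Context: Let $G=\mathrm U(n)$ or $\mathrm{Spin}(2n)$, with maximal torus $T$ covering or equal to the standard one of $\mathrm{SO}(2n)$ or $\mathrm U(n)$, Lie algebra $\mathfrak t\simeq\mathbb R^n$, complex coordinates $z_1,\dots,z_n$ on $\mathfrak t_{\mathbb C}$, cocharacter lattice $X_*(T)=\ker(\exp:\mathfrak t\to T)$ (for $\mathrm U(n)$ it is $\mathbb Z^n$; for $\mathrm{Spin}(2n)$ it is $\ker(\mathbb Z^n\xrightarrow{+}\mathbb Z/2)$), and Weyl group $W$. Holomorphic functions in $\tau\in\mathbb H$ are required to have at most polynomial growth along geodesics escaping to $\partial\mathbb H$. $\mathrm{Bun}_G(\mathcal E)=[\mathbb H\times\mathcal C^2[G]/\mathrm{SL}_2(\mathbb Z)\times\pi_0(G)]$, where $\mathcal C^2[G]$ is the coarse quotient sheaf (on the site of manifolds) of pairs of commuting elements of $G$ by conjugation by the identity component. Since $G$ is connected with torsion-free fundamental group, $\mathcal C^2[G]\simeq(T\times T)/^cW$ (coarse quotient), and the map $\mathbb H\times\mathfrak t_{\mathbb C}\simeq\mathbb H\times\mathfrak t\times\mathfrak t\to\mathbb H\times T\times T\to\mathrm{Bun}_G(\mathcal E)$, $(\tau,X_1-\tau X_2)\mapsto(\tau,e^{X_1},e^{X_2})$, is used to describe functions and sections on $\mathrm{Bun}_G(\mathcal E)$: a (local) function is holomorphic iff its pullback to $\mathbb H\times\mathfrak t_{\mathbb C}$ is, and holomorphic functions on $\mathrm{Bun}_G(\mathcal E)$ correspond to holomorphic functions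 of $(\tau,z)$ invariant under $W$ and under $X_*(T)^{\oplus2}\rtimes\mathrm{SL}_2(\mathbb Z)$, acting by $(\tau,z)\mapsto(\tau,z+m+n'\tau)$, $m,n'\in X_*(T)$, and $(\tau,z)\mapsto(\frac{a\tau+b}{c\tau+d},\frac z{c\tau+d})$. A holomorphic line bundle is a locally free rank one $\mathcal O_{\mathrm{Bun}_G(\mathcal E)}$-module; tensor products are over $\mathcal O_{\mathrm{Bun}_G(\mathcal E)}$. $\omega^{\otimes k}$ is the line bundle (pulled back from $[\mathbb H/\mathrm{SL}_2(\mathbb Z)]$) whose sections are functions multiplied by $(c\tau+d)^k$ under $\gamma\in\mathrm{SL}_2(\mathbb Z)$. $\widehat{\mathrm{Ell}}{}_G^{2n}(\mathrm{pt})$ is the sheaf of degree-$2n$ equivariant elliptic cocycles of a point. A section is a compatible family, over commuting pairs $h$, of invariant germs at $0$ of holomorphic functions on $\mathfrak g^h_{\mathbb C}$ with values in $\mathcal O(U)[\beta,\beta^{-1}]$, $U\subset\mathbb H$, with $|\beta|=-2$ and functions in degree $0$; compatibility means invariance under conjugation and, for $h'=(h_1e^{X_1},h_2e^{X_2})$ with $X_i$ small in a maximal commuting subalgebra of $\mathfrak g^h$, $\alpha_{h'}(X)=\alpha_h(X+X_1-\tau X_2)$. Equivalently, sections are expressions $\beta^{-n}f$ with $f$ a $W$- and $X_*(T)^{\oplus2}$-invariant holomorphic function of $(\tau,z)$; $\mathrm{SL}_2(\mathbb Z)$ acts also on $\beta$ by $\beta\mapsto\beta/(c\tau+d)$. With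 $q=e^{2\pi i\tau}$, $y=e^{2\pi iz}$, $y^{1/2}=e^{\pi iz}$, set $$\sigma(\tau,z)=(y^{1/2}-y^{-1/2})\prod_{m>0}\frac{(1-q^my)(1-q^my^{-1})}{(1-q^m)^2},\qquad \upsilon(\tau,z)=-y^{1/2}\sigma(\tau,z)=(1-y)\prod_{m>0}\frac{(1-q^my)(1-q^my^{-1})}{(1-q^m)^2},$$ $$\sigma_{\mathrm{SO}(2n)}=\prod_{j=1}^n\sigma(\tau,z_j),\qquad\sigma_{\mathrm U(n)}=\prod_{j=1}^n\upsilon(\tau,z_j)\quad\text{in }\mathcal O(\mathbb H\times\mathfrak t_{\mathbb C}).$$ Write $\sigma_G$ for $\sigma_{\mathrm U(n)}$ when $G=\mathrm U(n)$ and $\sigma_{\mathrm{SO}(2n)}$ when $G=\mathrm{Spin}(2n)$. $\mathcal A_G$ is the holomorphic line bundle on $\mathrm{Bun}_G(\mathcal E)$ defined by the transformation properties of $\sigma_G$: its sections are $W$-invariant holomorphic functions on (opens of) $\mathbb H\times\mathfrak t_{\mathbb C}$ transforming under $X_*(T)^{\oplus2}\rtimes\mathrm{SL}_2(\mathbb Z)$ by the same (nowhere vanishing) cocycle as $\sigma_G$; in particular $\sigma_G$ is a global section. $\mathcal L_G:=\mathcal A_G\otimes\omega^{\otimes n}$.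
   Formalization: For Spin(2n), n≥4, the sheaf L_G of W-invariant sections is not locally free on Bun_G(E) (coarse quotient by W); for Spin, local freeness of rank one is stated on H×T×T with a W-compatible cocycle, and the Euler class is a global section of the W-invariant sheaf for all n. *)

theory Defs
  imports
    "HOL-Analysis.Analysis"
    "HOL-Library.Landau_Symbols"
    "HOL-Library.Poly_Mapping"
begin

section \<open>The atlas and the groups acting on it\<close>

type_synonym 'n pt = "complex \<times> (complex ^ 'n)"

definition upper_half_plane :: "complex set"
  where "upper_half_plane = {\<tau>. Im \<tau> > 0}"

definition atlas :: "('n::finite) pt set"
  where "atlas = upper_half_plane \<times> UNIV"

text \<open>
  A compact connected Lie group of rank \<open>CARD('n)\<close> enters only through its cocharacter lattice
  \<open>ker (exp : \<t> \<rightarrow> T)\<close>, embedded in \<open>\<int>\<^sup>n \<subseteq> \<real>\<^sup>n = \<t>\<close>, and its Weyl group, whose elements are signed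
  permutations \<open>(\<epsilon>, \<pi>)\<close> acting by \<open>(w x)\<^sub>i = \<epsilon>\<^sub>i x\<^bsub>\<pi> i\<^esub>\<close>.
\<close>

type_synonym 'n signed_perm = "('n \<Rightarrow> int) \<times> ('n \<Rightarrow> 'n)"

record 'n lie_data =
  cochar :: "(int ^ 'n) set"
  weyl :: "'n signed_perm set"

definition unitary_group :: "('n::finite) lie_data"
  where "unitary_group = \<lparr>cochar = UNIV, weyl = {(\<lambda>_. 1, \<pi>) |\<pi>. bij \<pi>}\<rparr>"

text \<open>\<open>Spin(2n)\<close>, with \<open>n = CARD('n)\<close>; the Weyl group of type \<open>D\<^sub>n\<close> has evenly many sign changes.\<close>

definition spin_group :: "('n::finite) lie_data"
  where "spin_group = \<lparr>cochar = {m. even (\<Sum>i\<in>UNIV. m $ i)},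
    weyl = {(\<epsilon>, \<pi>). (\<forall>i. \<epsilon> i = 1 \<or> \<epsilon> i = -1) \<and> (\<Prod>i\<in>UNIV. \<epsilon> i) = 1 \<and> bij \<pi>}\<rparr>"

definition maximal_torus :: "('n::finite) lie_data \<Rightarrow> 'n lie_data"
  where "maximal_torus G = G\<lparr>weyl := {(\<lambda>_. 1, id)}\<rparr>"

definition weyl_act :: "('n::finite) signed_perm \<Rightarrow> ('a::ring_1) ^ 'n \<Rightarrow> 'a ^ 'n"
  where "weyl_act w x = (\<chi> i. of_int (fst w i) * x $ snd w i)"

definition SL2Z :: "(int ^ 2 ^ 2) set"
  where "SL2Z = {\<gamma>. det \<gamma> = 1}"

definition denom :: "int ^ 2 ^ 2 \<Rightarrow> complex \<Rightarrow> complex"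
  where "denom \<gamma> \<tau> = of_int (\<gamma> $ 2 $ 1) * \<tau> + of_int (\<gamma> $ 2 $ 2)"

definition moebius :: "int ^ 2 ^ 2 \<Rightarrow> complex \<Rightarrow> complex"
  where "moebius \<gamma> \<tau> = (of_int (\<gamma> $ 1 $ 1) * \<tau> + of_int (\<gamma> $ 1 $ 2)) / denom \<gamma> \<tau>"

text \<open>
  Elements \<open>(m, n, \<gamma>)\<close> of \<open>X\<^sub>*(T)\<^sup>\<oplus>\<^sup>2 \<rtimes> SL\<^sub>2(\<int>)\<close> act by the translation by \<open>m + n \<tau>\<close> followed by \<open>\<gamma>\<close>.
  The product is the one that makes this a left action; a matrix acts on pairs \<open>(n, m)\<close> from the right.
\<close>

type_synonym 'n jac = "(int ^ 'n) \<times> (int ^ 'n) \<times> (int ^ 2 ^ 2)"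

definition jacobi_group :: "('n::finite) lie_data \<Rightarrow> 'n jac set"
  where "jacobi_group G = cochar G \<times> cochar G \<times> SL2Z"

fun jacobi_act :: "('n::finite) jac \<Rightarrow> 'n pt \<Rightarrow> 'n pt"
  where "jacobi_act (m, n, \<gamma>) (\<tau>, z) =
    (moebius \<gamma> \<tau>, \<chi> i. (z $ i + of_int (m $ i) + of_int (n $ i) * \<tau>) / denom \<gamma> \<tau>)"

fun jacobi_mult :: "('n::finite) jac \<Rightarrow> 'n jac \<Rightarrow> 'n jac"
  where "jacobi_mult (m, n, \<gamma>) (m', n', \<gamma>') =
    ((\<chi> i. m $ i * \<gamma>' $ 2 $ 2 + n $ i * \<gamma>' $ 1 $ 2 + m' $ i),
     (\<chi> i. m $ i * \<gamma>' $ 2 $ 1 + n $ i * \<gamma>' $ 1 $ 1 + n' $ i),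
     \<gamma> ** \<gamma>')"

abbreviation translation :: "int ^ 'n \<Rightarrow> int ^ 'n \<Rightarrow> ('n::finite) jac"
  where "translation m n \<equiv> (m, n, mat 1)"

abbreviation modular :: "int ^ 2 ^ 2 \<Rightarrow> ('n::finite) jac"
  where "modular \<gamma> \<equiv> (0, 0, \<gamma>)"


section \<open>Holomorphic functions with the growth condition\<close>

definition holomorphic_at :: "(('n::finite) pt \<Rightarrow> complex) \<Rightarrow> 'n pt \<Rightarrow> bool"
  where "holomorphic_at f p \<longleftrightarrow>
    (\<exists>D. (f has_derivative D) (at p) \<and> (\<forall>c v. D (c * fst v, c *s snd v) = c * D v))"

definition partial_z :: "'n \<Rightarrow> (('n::finite) pt \<Rightarrow> complex) \<Rightarrow> 'n pt \<Rightarrow> complex"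
  where "partial_z i f p = deriv (\<lambda>w. f (fst p, snd p + axis i w)) 0"

text \<open>
  For a real matrix of determinant 1, \<open>t \<mapsto> geodesic A t\<close> is a hyperbolic geodesic with arc length
  parameter \<open>ln t\<close>, escaping to \<open>\<partial>\<H>\<close> as \<open>t \<rightarrow> \<infinity>\<close>; every geodesic end arises in this way.
\<close>

definition geodesic :: "real ^ 2 ^ 2 \<Rightarrow> real \<Rightarrow> complex"
  where "geodesic A t =
    (of_real (A $ 1 $ 1) * (\<i> * of_real t) + of_real (A $ 1 $ 2)) /
    (of_real (A $ 2 $ 1) * (\<i> * of_real t) + of_real (A $ 2 $ 2))"

text \<open>
  A function of \<open>(\<tau>, z)\<close> is a germ in \<open>z\<close> at 0 with values in functions of \<open>\<tau>\<close>, and the growth condition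
  is imposed on its Taylor coefficients. Polynomial means polynomial in \<open>t\<close> and not in the arc
  length: a modular form of weight \<open>k\<close> may grow like \<open>t\<^sup>k\<close> towards a real cusp. For fixed \<open>z \<noteq> 0\<close>, or
  along \<open>z = X\<^sub>1 - \<tau> X\<^sub>2\<close> with generic fixed \<open>X\<^sub>1, X\<^sub>2\<close>, the functions \<open>sigma\<close> and \<open>upsilon\<close> below do not have
  polynomial growth.
\<close>

definition poly_growth :: "('n::finite) pt set \<Rightarrow> ('n pt \<Rightarrow> complex) \<Rightarrow> bool"
  where "poly_growth V f \<longleftrightarrow>
    (\<forall>A is. det A = 1 \<longrightarrow> (\<forall>\<^sub>F t in at_top. (geodesic A t, 0) \<in> V) \<longrightarrow>
      (\<exists>N::nat. (\<lambda>t. norm (foldr partial_z is f (geodesic A t, 0))) \<in> O[at_top](\<lambda>t::real. t ^ N)))"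

definition hol :: "('n::finite) pt set \<Rightarrow> ('n pt \<Rightarrow> complex) set"
  where "hol V = {f. (\<forall>p\<in>V. holomorphic_at f p) \<and> poly_growth V f}"


section \<open>Laurent polynomials in \<open>\<beta>\<close>\<close>

text \<open>\<open>\<complex>[\<beta>, \<beta>\<^sup>-\<^sup>1]\<close> is the group algebra of \<open>\<int>\<close>; \<open>\<beta>\<close> has degree \<open>-2\<close>.\<close>

type_synonym laurent = "int \<Rightarrow>\<^sub>0 complex"

definition const :: "complex \<Rightarrow> laurent"
  where "const a = Poly_Mapping.single 0 a"

definition beta_pow :: "int \<Rightarrow> laurent"
  where "beta_pow k = Poly_Mapping.single k 1"

definition homogeneous :: "int \<Rightarrow> laurent \<Rightarrow> bool"
  where "homogeneous d a \<longleftrightarrow> (\<forall>k\<in>Poly_Mapping.keys a. -2 * k = d)"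

text \<open>The substitution \<open>\<beta> \<mapsto> \<beta> / u\<close>.\<close>

definition beta_div :: "complex \<Rightarrow> laurent \<Rightarrow> laurent"
  where "beta_div u a = Poly_Mapping.mapp (\<lambda>k x. x * u powi (- k)) a"


section \<open>Module sheaves on \<open>Bun\<^sub>G(\<E>)\<close>\<close>

text \<open>
  Opens of \<open>\<H> \<times> (T \<times> T)/W\<close>, as invariant opens of the atlas \<open>\<H> \<times> \<t>\<^sub>\<complex>\<close>.
\<close>

definition opens :: "('n::finite) lie_data \<Rightarrow> 'n pt set set"
  where "opens G = {V. open V \<and> V \<subseteq> atlas \<and>
    (\<forall>w\<in>weyl G. \<forall>(\<tau>, z)\<in>V. (\<tau>, weyl_act w z) \<in> V) \<and>
    (\<forall>m\<in>cochar G. \<forall>n\<in>cochar G. \<forall>p\<in>V. jacobi_act (translation m n) p \<in> V)}"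

text \<open>
  A module on \<open>Bun\<^sub>G(\<E>) = [\<H> \<times> (T \<times> T)/W / SL\<^sub>2(\<int>)]\<close> is given by its sections on the opens of
  \<open>\<H> \<times> (T \<times> T)/W\<close>, pulled back to the atlas, and by the factor of automorphy through which
  \<open>SL\<^sub>2(\<int>)\<close> acts. Sections over \<open>V\<close> are functions that matter only on \<open>V\<close>. In addition to the factor,
  \<open>\<gamma>\<close> always acts on \<open>\<beta>\<close> by \<open>\<beta> \<mapsto> \<beta> / (c\<tau> + d)\<close>.
\<close>

record 'n module_sheaf =
  secs :: "'n pt set \<Rightarrow> ('n pt \<Rightarrow> laurent) set"
  factor :: "int ^ 2 ^ 2 \<Rightarrow> 'n pt \<Rightarrow> complex"

definition global_sections :: "('n::finite) module_sheaf \<Rightarrow> ('n pt \<Rightarrow> laurent) set"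
  where "global_sections F = {\<Phi> \<in> secs F atlas. \<forall>\<gamma>\<in>SL2Z. \<forall>p\<in>atlas.
    beta_div (denom \<gamma> (fst p)) (\<Phi> (jacobi_act (modular \<gamma>) p)) = const (factor F \<gamma> p) * \<Phi> p}"

text \<open>
  The tensor product over \<open>\<O>\<close>, realised by multiplication of functions. This is the tensor product
  of sheaves whenever one of the two modules is free of rank one over \<open>\<O>\<close> on the atlas (generated by a
  section that is nowhere a zero divisor), as is the case for the modules \<open>omega\<close> and \<open>ell\<close> below:
  then the multiplication map is injective and the presheaf tensor product is already a sheaf.
\<close>

definition tensor :: "('n::finite) module_sheaf \<Rightarrow> 'n module_sheaf \<Rightarrow> 'n module_sheaf"
  where "tensor F E = \<lparr>
    secs = (\<lambda>V. {\<Phi>. \<exists>(k::nat) a b. (\<forall>i<k. a i \<in> secs F V \<and> b i \<in> secs E V) \<and>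
                     (\<forall>p\<in>V. \<Phi> p = (\<Sum>i<k. a i p * b i p))}),
    factor = (\<lambda>\<gamma> p. factor F \<gamma> p * factor E \<gamma> p)\<rparr>"

text \<open>
  Nowhere vanishing holomorphic cocycles of \<open>X\<^sub>*(T)\<^sup>\<oplus>\<^sup>2 \<rtimes> SL\<^sub>2(\<int>)\<close>, compatible with the trivial cocycle
  on \<open>W\<close>.
\<close>

definition automorphy_cocycle :: "('n::finite) lie_data \<Rightarrow> ('n jac \<Rightarrow> 'n pt \<Rightarrow> complex) \<Rightarrow> bool"
  where "automorphy_cocycle G j \<longleftrightarrow>
    (\<forall>g\<in>jacobi_group G. \<forall>p\<in>atlas. holomorphic_at (j g) p \<and> j g p \<noteq> 0) \<and>
    (\<forall>g\<in>jacobi_group G. \<forall>h\<in>jacobi_group G. \<forall>p\<in>atlas.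
       j (jacobi_mult g h) p = j g (jacobi_act h p) * j h p) \<and>
    (\<forall>w\<in>weyl G. \<forall>(m, n, \<gamma>)\<in>jacobi_group G. \<forall>(\<tau>, z)\<in>atlas.
       j (weyl_act w m, weyl_act w n, \<gamma>) (\<tau>, weyl_act w z) = j (m, n, \<gamma>) (\<tau>, z))"

definition transforms_by ::
    "('n::finite) lie_data \<Rightarrow> ('n jac \<Rightarrow> 'n pt \<Rightarrow> complex) \<Rightarrow> ('n pt \<Rightarrow> complex) \<Rightarrow> bool"
  where "transforms_by G j f \<longleftrightarrow>
    (\<forall>g\<in>jacobi_group G. \<forall>p\<in>atlas. f (jacobi_act g p) = j g p * f p)"

definition automorphic_sheaf ::
    "('n::finite) lie_data \<Rightarrow> ('n jac \<Rightarrow> 'n pt \<Rightarrow> complex) \<Rightarrow> 'n module_sheaf"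
  where "automorphic_sheaf G j = \<lparr>
    secs = (\<lambda>V. {\<Phi>. \<exists>f\<in>hol V. (\<forall>p\<in>V. \<Phi> p = const (f p)) \<and>
      (\<forall>w\<in>weyl G. \<forall>(\<tau>, z)\<in>V. f (\<tau>, weyl_act w z) = f (\<tau>, z)) \<and>
      (\<forall>m\<in>cochar G. \<forall>n\<in>cochar G. \<forall>p\<in>V.
         f (jacobi_act (translation m n) p) = j (translation m n) p * f p)}),
    factor = (\<lambda>\<gamma>. j (modular \<gamma>))\<rparr>"

definition structure_sheaf :: "('n::finite) lie_data \<Rightarrow> 'n module_sheaf"
  where "structure_sheaf G = automorphic_sheaf G (\<lambda>_ _. 1)"

definition omega :: "('n::finite) lie_data \<Rightarrow> nat \<Rightarrow> 'n module_sheaf"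
  where "omega G k = automorphic_sheaf G (\<lambda>(m, n, \<gamma>) p. denom \<gamma> (fst p) ^ k)"

text \<open>
  On the atlas the cocycle of \<open>s\<close> is unique whenever the zero set of \<open>s\<close> has empty interior.
\<close>

definition cocycle_of ::
    "('n::finite) lie_data \<Rightarrow> ('n pt \<Rightarrow> complex) \<Rightarrow> 'n jac \<Rightarrow> 'n pt \<Rightarrow> complex"
  where "cocycle_of G s = (SOME j. automorphy_cocycle G j \<and> transforms_by G j s)"

definition A_sheaf :: "('n::finite) lie_data \<Rightarrow> ('n pt \<Rightarrow> complex) \<Rightarrow> 'n module_sheaf"
  where "A_sheaf G s = automorphic_sheaf G (cocycle_of G s)"

definition L_sheaf :: "('n::finite) lie_data \<Rightarrow> ('n pt \<Rightarrow> complex) \<Rightarrow> 'n module_sheaf"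
  where "L_sheaf G s = tensor (A_sheaf G s) (omega G CARD('n))"

text \<open>
  Local freeness of rank one is tested on \<open>\<H> \<times> (T \<times> T)/W\<close>, which covers the stack: each point has a
  neighbourhood \<open>V\<close> with a section \<open>s\<close> such that \<open>c \<mapsto> c s\<close> is bijective from \<open>\<O>\<close> to \<open>F\<close> over
  every open subset of \<open>V\<close>.
\<close>

text \<open>
  Applied to \<open>maximal_torus G\<close>, this is local freeness on \<open>\<H> \<times> T \<times> T\<close>, before the quotient by \<open>W\<close>.
  For \<open>Spin(2n)\<close> with \<open>n \<ge> 4\<close> the \<open>W\<close>-invariant sections are not locally free on the coarse quotient: the
  map \<open>z \<mapsto> -z + (0, 1, \<tau>, 1+\<tau>)\<close> on four of the coordinates fixes \<open>(0, 1/2, \<tau>/2, (1+\<tau>)/2)\<close>, and the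
  cocycle of \<open>sigma_SO\<close> takes the value \<open>-1\<close> there.
\<close>

definition locally_free_rank_one :: "('n::finite) lie_data \<Rightarrow> 'n module_sheaf \<Rightarrow> bool"
  where "locally_free_rank_one G F \<longleftrightarrow>
    (\<forall>p\<in>atlas. \<exists>V\<in>opens G. p \<in> V \<and> (\<exists>s. \<forall>V'\<in>opens G. V' \<subseteq> V \<longrightarrow>
      (\<forall>\<Phi>. \<Phi> \<in> secs F V' \<longleftrightarrow> (\<exists>c\<in>secs (structure_sheaf G) V'. \<forall>q\<in>V'. \<Phi> q = c q * s q)) \<and>
      (\<forall>c\<in>secs (structure_sheaf G) V'. \<forall>c'\<in>secs (structure_sheaf G) V'.
         (\<forall>q\<in>V'. c q * s q = c' q * s q) \<longrightarrow> (\<forall>q\<in>V'. c q = c' q))))"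


section \<open>Equivariant elliptic cocycles of a point\<close>

definition flat :: "real ^ 'n \<Rightarrow> real ^ 'n \<Rightarrow> complex \<Rightarrow> complex ^ ('n::finite)"
  where "flat X1 X2 \<tau> = (\<chi> i. of_real (X1 $ i) - \<tau> * of_real (X2 $ i))"

definition real_vec :: "int ^ 'n \<Rightarrow> real ^ ('n::finite)"
  where "real_vec m = (\<chi> i. of_int (m $ i))"

text \<open>
  A family \<open>\<alpha>\<^sub>h\<close> of germs is indexed by logarithms \<open>(X\<^sub>1, X\<^sub>2)\<close> of pairs \<open>h = (e\<^bsup>X1\<^esup>, e\<^bsup>X2\<^esup>)\<close> in \<open>T \<times> T\<close>, to
  which every commuting pair is conjugate. Likewise an invariant function on \<open>\<g>\<^sup>h\<^sub>\<complex>\<close> is given by its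
  restriction to \<open>\<t>\<^sub>\<complex>\<close>, so that conjugation reduces to the action of \<open>W\<close>. Germs at \<open>(\<tau>, 0)\<close> are
  represented by functions and compared on neighbourhoods. The section over \<open>V\<close> comprises the germs
  at those \<open>\<tau>\<close> for which the image of \<open>(\<tau>, h)\<close> lies in \<open>V\<close>.
\<close>

definition elliptic_cocycle ::
    "('n::finite) lie_data \<Rightarrow> int \<Rightarrow> 'n pt set \<Rightarrow> (real ^ 'n \<Rightarrow> real ^ 'n \<Rightarrow> 'n pt \<Rightarrow> laurent) \<Rightarrow> bool"
  where "elliptic_cocycle G d V \<alpha> \<longleftrightarrow>
    (\<forall>k. poly_growth V (\<lambda>p. Poly_Mapping.lookup (\<alpha> 0 0 p) k)) \<and>
    (\<forall>X1 X2 \<tau>. (\<tau>, flat X1 X2 \<tau>) \<in> V \<longrightarrow>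
      (\<forall>\<^sub>F p in nhds (\<tau>, 0). homogeneous d (\<alpha> X1 X2 p) \<and>
         (\<forall>k. holomorphic_at (\<lambda>p'. Poly_Mapping.lookup (\<alpha> X1 X2 p') k) p)) \<and>
      (\<forall>m\<in>cochar G. \<forall>n\<in>cochar G.
         \<forall>\<^sub>F p in nhds (\<tau>, 0). \<alpha> (X1 + real_vec m) (X2 + real_vec n) p = \<alpha> X1 X2 p) \<and>
      (\<forall>w\<in>weyl G. \<forall>\<^sub>F (\<tau>', X) in nhds (\<tau>, 0).
         \<alpha> (weyl_act w X1) (weyl_act w X2) (\<tau>', weyl_act w X) = \<alpha> X1 X2 (\<tau>', X)) \<and>
      (\<forall>\<^sub>F (Y1, Y2, \<tau>', X) in nhds (0, 0, \<tau>, 0).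
         \<alpha> (X1 + Y1) (X2 + Y2) (\<tau>', X) = \<alpha> X1 X2 (\<tau>', X + flat Y1 Y2 \<tau>')))"

text \<open>
  By compatibility the family is determined by the function \<open>(\<tau>, X\<^sub>1 - \<tau> X\<^sub>2) \<mapsto> \<alpha>\<^sub>h(0)\<close> on \<open>V\<close>.
\<close>

definition ell :: "('n::finite) lie_data \<Rightarrow> int \<Rightarrow> 'n module_sheaf"
  where "ell G d = \<lparr>
    secs = (\<lambda>V. {\<Phi>. \<exists>\<alpha>. elliptic_cocycle G d V \<alpha> \<and>
      (\<forall>X1 X2 \<tau>. (\<tau>, flat X1 X2 \<tau>) \<in> V \<longrightarrow> \<Phi> (\<tau>, flat X1 X2 \<tau>) = \<alpha> X1 X2 (\<tau>, 0))}),
    factor = (\<lambda>_ _. 1)\<rparr>"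


section \<open>The sigma functions and the Euler classes\<close>

definition sigma :: "complex \<Rightarrow> complex \<Rightarrow> complex"
  where "sigma \<tau> z = (let q = exp (2 * of_real pi * \<i> * \<tau>); y = exp (2 * of_real pi * \<i> * z) in
    (exp (of_real pi * \<i> * z) - exp (- (of_real pi * \<i> * z))) *
    prodinf (\<lambda>m. (1 - q ^ Suc m * y) * (1 - q ^ Suc m * inverse y) / (1 - q ^ Suc m)\<^sup>2))"

definition upsilon :: "complex \<Rightarrow> complex \<Rightarrow> complex"
  where "upsilon \<tau> z = - exp (of_real pi * \<i> * z) * sigma \<tau> z"

definition sigma_SO :: "('n::finite) pt \<Rightarrow> complex"
  where "sigma_SO p = (\<Prod>j\<in>UNIV. sigma (fst p) (snd p $ j))"

definition sigma_U :: "('n::finite) pt \<Rightarrow> complex"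
  where "sigma_U p = (\<Prod>j\<in>UNIV. upsilon (fst p) (snd p $ j))"

definition Eu_Spin :: "('n::finite) pt \<Rightarrow> laurent"
  where "Eu_Spin p = beta_pow (- int CARD('n)) * const (sigma_SO p)"

definition Eu_U :: "('n::finite) pt \<Rightarrow> laurent"
  where "Eu_U p = beta_pow (- int CARD('n)) * const (sigma_U p)"

end

theory Submission
  imports Defs "HOL-Complex_Analysis.Complex_Singularities"
begin

text \<open>
  Both Euler classes are \<open>\<beta>\<^bsup>-n\<^esup>\<close> times a product of values of one function of two variables, the
  theta quotient \<open>sigma\<close>, with a twist by \<open>-y\<^bsup>1/2\<^esup>\<close> in the unitary case. The whole statement rests on
  the transformation behaviour of \<open>sigma\<close>.

  Under translations of \<open>z\<close> by the lattice \<open>\<int> + \<int> \<tau>\<close>, \<open>sigma\<close> is multiplied by an exponential: this is a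
  telescoping in the infinite product (\<open>sigma_quasi_periodic\<close>). Its zeros are simple and are exactly the
  lattice points (\<open>sigma_eq_0_iff\<close>). These two facts determine \<open>sigma \<tau>\<close> up to a constant, and its
  derivative at 0 determines the constant, so the modular law follows from Liouville's theorem applied
  to a quotient (\<open>sigma_modular\<close>). The product of the resulting one-variable factors is an explicit
  nowhere vanishing holomorphic function \<open>jacobi_factor\<close>; since the zeros of \<open>sigma_prod\<close> are nowhere dense,
  it satisfies the cocycle identity and is the only cocycle for \<open>sigma_prod\<close> (\<open>jacobi_factor_cocycle\<close>,
  \<open>cocycle_of_eq\<close>).

  The growth condition concerns the Taylor coefficients of \<open>sigma\<close> at \<open>z = 0\<close>. By Cauchy's inequality it
  suffices to bound \<open>sigma\<close> on a disc whose radius shrinks polynomially with \<open>Im \<tau>\<close>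
  (\<open>sigma_bounded_near_0\<close>). Such a bound comes from the product itself and is uniform in \<open>Re \<tau>\<close>, so that
  irrational boundary points are treated like cusps.

  For local freeness a nowhere vanishing local section with the automorphy factor of \<open>sigma_prod\<close> is
  needed near every point. The quotient \<open>sigma (z - a)\<^sup>2 / sigma (z - 2 a)\<close> in each coordinate, with
  generic \<open>a\<close>, is one (\<open>locally_free_L_sheaf\<close>). It is symmetric under permutations, which covers \<open>U(n)\<close>
  on the coarse quotient and \<open>Spin(2n)\<close> on the torus.

  Finally \<open>\<beta>\<^bsup>-n\<^esup>\<close> is a section of the elliptic cocycles of degree \<open>2 n\<close>, and the power of the denominator
  that it acquires under modular matrices is the one recorded by \<open>omega\<close>
  (\<open>Euler_class_global_section\<close>).
\<close>

section \<open>Separately holomorphic functions of two variables\<close>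

text \<open>
  Osgood's lemma. Cauchy's inequality, applied to the difference of two translates of \<open>f\<close> in the
  second variable, bounds the difference of the partial derivatives by the difference of the values
  of \<open>f\<close> on a slightly larger bidisc. Uniform continuity there makes the partial derivative jointly
  continuous, and one continuous partial derivative is enough for differentiability.
\<close>

lemma osgood:
  fixes f :: "complex \<Rightarrow> complex \<Rightarrow> complex"
  assumes S: "open S" "(a, b) \<in> S"
    and cont: "continuous_on S (\<lambda>(x, y). f x y)"
    and hol1: "\<And>x y. (x, y) \<in> S \<Longrightarrow> (\<lambda>x. f x y) field_differentiable at x"
    and hol2: "\<And>x y. (x, y) \<in> S \<Longrightarrow> f x field_differentiable at y"
  shows "\<exists>\<alpha> \<beta>. ((\<lambda>(x, y). f x y) has_derivative (\<lambda>(s, t). \<alpha> * s + \<beta> * t)) (at (a, b))"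
proof -
  obtain A B where AB: "open A" "open B" "a \<in> A" "b \<in> B" "A \<times> B \<subseteq> S"
    using open_prod_elim[OF S] by (metis mem_Sigma_iff)
  obtain r0 where r0: "r0 > 0" "cball a r0 \<subseteq> A"
    using AB open_contains_cball by blast
  obtain r1 where r1: "r1 > 0" "cball b r1 \<subseteq> B"
    using AB open_contains_cball by blast
  define r where "r = min r0 r1 / 3"
  have r: "r > 0" "3 * r \<le> r0" "3 * r \<le> r1"
    using r0 r1 by (auto simp: r_def)
  define K where "K = cball a (3 * r) \<times> cball b (3 * r)"
  have K: "compact K" "K \<subseteq> S"
    using r0 r1 r AB unfolding K_def by (auto intro!: compact_Times simp: subset_iff)
  have inK: "(x, y) \<in> K" if "dist a x \<le> 3 * r" "dist b y \<le> 3 * r" for x y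
    using that by (simp add: K_def)
  have uc: "uniformly_continuous_on K (\<lambda>(x, y). f x y)"
    using K cont by (intro compact_uniformly_continuous) (auto intro: continuous_on_subset)
  have hol2': "f x field_differentiable at y" if "dist a x \<le> 3 * r" "dist b y \<le> 3 * r" for x y
    using hol2 inK[OF that] K by blast
  have Df: "((\<lambda>y. f x y) has_field_derivative deriv (f x) y) (at y)"
    if "dist a x \<le> 3 * r" "dist b y \<le> 3 * r" for x y
    using hol2'[OF that] by (simp add: DERIV_deriv_iff_field_differentiable)
  have cont_deriv: "((\<lambda>(x, y). deriv (f x) y) \<longlongrightarrow> deriv (f a) b) (at (a, b) within ball a r \<times> ball b r)"
  proof (rule tendstoI)
    fix e :: real assume e: "e > 0"
    obtain d where d: "d > 0" "\<And>p p'. p \<in> K \<Longrightarrow> p' \<in> K \<Longrightarrow> dist p' p < d \<Longrightarrow>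
        dist ((\<lambda>(x, y). f x y) p') ((\<lambda>(x, y). f x y) p) < e * r / 2"
      using uc e r(1) unfolding uniformly_continuous_on_def
      by (metis half_gt_zero mult_pos_pos)
    have main: "dist (deriv (f x) y) (deriv (f a) b) < e"
      if xy: "x \<in> ball a r" "y \<in> ball b r" "dist (x, y) (a, b) < d" for x y
    proof -
      define g where "g = (\<lambda>w. f x (y + w) - f a (b + w))"
      have dgt: "(g has_field_derivative (deriv (f x) (y + w) - deriv (f a) (b + w))) (at w)"
        if "norm w \<le> r" for w
      proof -
        have "dist b (y + w) \<le> dist b y + dist y (y + w)" by (rule dist_triangle)
        also have "\<dots> \<le> r + r" using xy that by (auto intro!: add_mono simp: dist_norm)
        finally have *: "dist b (y + w) \<le> 3 * r" using r by simp
        have **: "dist b (b + w) \<le> 3 * r" using that r by (simp add: dist_norm)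
        have 1: "(f x has_field_derivative deriv (f x) (y + w)) (at (y + w))"
          using Df[of x "y + w"] * xy r by auto
        have 2: "(f a has_field_derivative deriv (f a) (b + w)) (at (b + w))"
          using Df[of a "b + w"] ** r by auto
        have 3: "((\<lambda>w. f x (y + w)) has_field_derivative deriv (f x) (y + w)) (at w)"
          using 1 DERIV_shift[of "f x" "deriv (f x) (y + w)" w y] by (simp add: add.commute)
        have 4: "((\<lambda>w. f a (b + w)) has_field_derivative deriv (f a) (b + w)) (at w)"
          using 2 DERIV_shift[of "f a" "deriv (f a) (b + w)" w b] by (simp add: add.commute)
        show ?thesis unfolding g_def using 3 4 by (rule DERIV_diff)
      qed
      have "norm ((deriv ^^ 1) g 0) \<le> fact 1 * (e * r / 2) / r ^ 1"
      proof (rule Cauchy_inequality)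
        show "g holomorphic_on ball 0 r"
          unfolding holomorphic_on_def
        proof
          fix w :: complex assume "w \<in> ball 0 r"
          then have "g field_differentiable at w" unfolding field_differentiable_def using dgt[of w] by auto
          then show "g field_differentiable at w within ball 0 r" by (rule field_differentiable_at_within)
        qed
        show "continuous_on (cball 0 r) g"
          using dgt by (intro continuous_at_imp_continuous_on ballI) (auto intro: DERIV_isCont)
        fix w :: complex assume w: "norm (0 - w) = r"
        have "dist b (y + w) \<le> dist b y + dist y (y + w)" by (rule dist_triangle)
        also have "\<dots> \<le> r + r" using xy w by (auto intro!: add_mono simp: dist_norm)
        finally have *: "dist b (y + w) \<le> 3 * r" using r by simp
        have k: "(x, y + w) \<in> K" "(a, b + w) \<in> K"
        proof -
          have "dist a x \<le> 3 * r" using xy(1) r(1) by simp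
          then show "(x, y + w) \<in> K" using * by (rule inK)
          show "(a, b + w) \<in> K" using w r(1) by (intro inK) (simp_all add: dist_norm)
        qed
        have "dist (x, y + w) (a, b + w) < d"
          using xy(3) by (simp add: dist_Pair_Pair dist_norm)
        from d(2)[OF k(2) k(1) this] show "norm (g w) \<le> e * r / 2"
          by (simp add: g_def dist_norm)
      qed (use r in auto)
      moreover have "deriv g 0 = deriv (f x) y - deriv (f a) b"
        using dgt[of 0] r by (auto intro: DERIV_imp_deriv)
      ultimately have "norm (deriv (f x) y - deriv (f a) b) \<le> e / 2"
        using r by simp
      then show ?thesis using e by (simp add: dist_norm)
    qed
    show "\<forall>\<^sub>F p in at (a, b) within ball a r \<times> ball b r.
        dist (case p of (x, y) \<Rightarrow> deriv (f x) y) (deriv (f a) b) < e"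
      unfolding eventually_at using d(1) main by (intro exI[of _ d]) auto
  qed
  have "((\<lambda>(x, y). f x y) has_derivative (\<lambda>(s, t). deriv (\<lambda>x. f x b) a * s +
      blinfun_apply (blinfun_mult_right (deriv (f a) b)) t)) (at (a, b) within ball a r \<times> ball b r)"
  proof (rule has_derivative_partialsI)
    have "((\<lambda>x. f x b) has_field_derivative deriv (\<lambda>x. f x b) a) (at a)"
      using hol1[OF S(2)] by (simp add: DERIV_deriv_iff_field_differentiable)
    then show "((\<lambda>x. f x b) has_derivative (*) (deriv (\<lambda>x. f x b) a)) (at a within ball a r)"
      using has_derivative_at_withinI has_field_derivative_def by blast
    show "(f x has_derivative blinfun_apply (blinfun_mult_right (deriv (f x) y))) (at y within ball b r)"
      if "x \<in> ball a r" "y \<in> ball b r" for x y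
      using Df[of x y] that r has_derivative_at_withinI by (force simp: has_field_derivative_def)
    show "continuous (at (a, b) within ball a r \<times> ball b r) (\<lambda>(x, y). blinfun_mult_right (deriv (f x) y))"
      unfolding continuous_within using bounded_linear.tendsto[OF bounded_linear_blinfun_mult_right cont_deriv]
      by (simp add: case_prod_unfold)
  qed (use r in auto)
  moreover have "at (a, b) within ball a r \<times> ball b r = at (a, b)"
    using r by (intro at_within_open) (auto intro: open_Times)
  ultimately show ?thesis by auto
qed

section \<open>The product expansion\<close>

definition nome :: "complex \<Rightarrow> complex"
  where "nome \<tau> = exp (2 * of_real pi * \<i> * \<tau>)"

definition two_sinh :: "complex \<Rightarrow> complex"
  where "two_sinh z = exp (of_real pi * \<i> * z) - exp (- (of_real pi * \<i> * z))"

definition product_coef :: "complex \<Rightarrow> nat \<Rightarrow> complex"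
  where "product_coef \<tau> m = nome \<tau> ^ Suc m / (1 - nome \<tau> ^ Suc m)\<^sup>2"

text \<open>
  The two factors of the product for \<open>sigma\<close> that contain \<open>q\<^sup>m\<close> depend on \<open>y\<close> only through
  \<open>y + 1/y - 2\<close>, which is the square of \<open>s = y\<^bsup>1/2\<^esup> - y\<^bsup>-1/2\<^esup>\<close>. Hence \<open>sigma = s E(\<tau>, s\<^sup>2)\<close> with a product
  \<open>E\<close> whose factors are affine in \<open>s\<^sup>2\<close>; its convergence, its holomorphy and a bound that is uniform
  as \<open>\<tau>\<close> approaches the boundary are all read off from the coefficients.
\<close>

definition even_factor :: "complex \<Rightarrow> complex \<Rightarrow> complex"
  where "even_factor \<tau> w = prodinf (\<lambda>m. 1 - product_coef \<tau> m * w)"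

lemma nome_nonzero [simp]: "nome \<tau> \<noteq> 0"
  by (simp add: nome_def)

lemma norm_nome: "norm (nome \<tau>) = exp (- (2 * pi * Im \<tau>))"
  by (simp add: nome_def)

lemma norm_nome_less_1: "Im \<tau> > 0 \<Longrightarrow> norm (nome \<tau>) < 1"
  by (simp add: norm_nome)

lemma one_minus_nome_power_nonzero: "Im \<tau> > 0 \<Longrightarrow> 1 - nome \<tau> ^ Suc m \<noteq> 0"
  using power_less_one_iff[of "norm (nome \<tau>)" "Suc m"] norm_nome_less_1[of \<tau>]
  by (metis eq_iff_diff_eq_0 norm_ge_zero norm_one norm_power order_less_irrefl zero_less_Suc)

lemma norm_coef_le:
  assumes "norm (nome \<tau>) \<le> r" "r < 1"
  shows "norm (product_coef \<tau> m) \<le> r ^ Suc m / (1 - r)\<^sup>2"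
proof -
  have r0: "0 \<le> r" using assms(1) norm_ge_zero order_trans by blast
  have p: "norm (nome \<tau> ^ Suc m) \<le> r ^ Suc m"
    unfolding norm_power using assms by (intro power_mono) auto
  have "r ^ Suc m \<le> r ^ 1"
    using assms r0 by (intro power_decreasing) auto
  then have "1 - r \<le> norm (1 - nome \<tau> ^ Suc m)"
    using norm_triangle_ineq2[of 1 "nome \<tau> ^ Suc m"] p by simp
  then have "(1 - r)\<^sup>2 \<le> (norm (1 - nome \<tau> ^ Suc m))\<^sup>2"
    using assms by (intro power_mono) auto
  then have "norm (nome \<tau> ^ Suc m) / (norm (1 - nome \<tau> ^ Suc m))\<^sup>2 \<le> r ^ Suc m / (1 - r)\<^sup>2"
    using p assms r0 by (intro frac_le) auto
  then show ?thesis by (simp add: product_coef_def norm_divide norm_power)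
qed

lemma summable_coef_bound:
  assumes "0 \<le> r" "r < (1::real)"
  shows "summable (\<lambda>m. r ^ Suc m / (1 - r)\<^sup>2 * B)"
  using assms by (intro summable_mult2 summable_divide summable_Suc_iff[THEN iffD2] summable_geometric) auto

lemma summable_norm_coef:
  assumes "Im \<tau> > 0"
  shows "summable (\<lambda>m. norm (product_coef \<tau> m * w))"
proof (rule summable_comparison_test')
  show "summable (\<lambda>m. norm (nome \<tau>) ^ Suc m / (1 - norm (nome \<tau>))\<^sup>2 * norm w)"
    using norm_nome_less_1[OF assms] by (intro summable_coef_bound) auto
  show "norm (norm (product_coef \<tau> m * w)) \<le> norm (nome \<tau>) ^ Suc m / (1 - norm (nome \<tau>))\<^sup>2 * norm w" for m
    unfolding norm_mult norm_of_real real_norm_def abs_mult abs_norm_cancel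
    using norm_coef_le[OF order_refl norm_nome_less_1[OF assms], of m]
    by (intro mult_right_mono) auto
qed

lemma convergent_prod_even_factor:
  assumes "Im \<tau> > 0"
  shows "convergent_prod (\<lambda>m. 1 - product_coef \<tau> m * w)"
  using summable_norm_coef[OF assms, of w]
  by (intro abs_convergent_prod_imp_convergent_prod) (simp add: abs_convergent_prod_conv_summable)

lemma even_factor_limit:
  assumes "Im \<tau> > 0"
  shows "(\<lambda>N. \<Prod>m<N. 1 - product_coef \<tau> m * w) \<longlonglongrightarrow> even_factor \<tau> w"
  using convergent_prod_LIMSEQ[OF convergent_prod_even_factor[OF assms, of w]]
  by (simp add: even_factor_def LIMSEQ_lessThan_iff_atMost)

lemma even_factor_eq_0_iff:
  assumes "Im \<tau> > 0"
  shows "even_factor \<tau> w = 0 \<longleftrightarrow> (\<exists>m. product_coef \<tau> m * w = 1)"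
proof
  assume "even_factor \<tau> w = 0"
  then show "\<exists>m. product_coef \<tau> m * w = 1"
    using prodinf_nonzero[OF convergent_prod_even_factor[OF assms, of w]] by (force simp: even_factor_def)
next
  assume "\<exists>m. product_coef \<tau> m * w = 1"
  then obtain m where m: "product_coef \<tau> m * w = 1" by blast
  have "\<forall>\<^sub>F N in sequentially. (\<Prod>m<N. 1 - product_coef \<tau> m * w) = 0"
    using eventually_gt_at_top[of m] by eventually_elim (use m in \<open>auto intro!: prod_zero\<close>)
  then have "(\<lambda>N. \<Prod>m<N. 1 - product_coef \<tau> m * w) \<longlonglongrightarrow> 0"
    by (rule tendsto_eventually)
  then show "even_factor \<tau> w = 0"
    using even_factor_limit[OF assms] LIMSEQ_unique by blast
qed

lemma two_sinh_square: "(two_sinh z)\<^sup>2 = exp (2 * of_real pi * \<i> * z) + inverse (exp (2 * of_real pi * \<i> * z)) - 2"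
proof -
  have "exp (2 * of_real pi * \<i> * z) = exp (of_real pi * \<i> * z) ^ 2"
    by (simp flip: exp_double add: mult_ac)
  then show ?thesis
    by (simp add: two_sinh_def exp_minus field_simps power2_eq_square)
qed

lemma sigma_factor_eq:
  assumes "Im \<tau> > 0" and y: "y = exp (2 * of_real pi * \<i> * z)"
  shows "(1 - nome \<tau> ^ Suc m * y) * (1 - nome \<tau> ^ Suc m * inverse y) / (1 - nome \<tau> ^ Suc m)\<^sup>2
    = 1 - product_coef \<tau> m * (two_sinh z)\<^sup>2"
proof -
  define Q where "Q = nome \<tau> ^ Suc m"
  have Q: "1 - Q \<noteq> 0" using one_minus_nome_power_nonzero[OF assms(1)] by (simp add: Q_def del: power_Suc)
  have y0: "y \<noteq> 0" by (simp add: y)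
  have "(1 - Q * y) * (1 - Q * inverse y) = (1 - Q)\<^sup>2 - Q * (y + inverse y - 2)"
    using y0 by (simp add: field_simps power2_eq_square)
  then show ?thesis
    using Q unfolding product_coef_def two_sinh_square y[symmetric] Q_def[symmetric]
    by (simp add: diff_divide_distrib)
qed

lemma sigma_eq:
  assumes "Im \<tau> > 0"
  shows "sigma \<tau> z = two_sinh z * even_factor \<tau> ((two_sinh z)\<^sup>2)"
  unfolding sigma_def Let_def sigma_factor_eq[OF assms refl, unfolded nome_def[of \<tau>]]
  by (simp add: two_sinh_def even_factor_def)

text \<open>
  Locally uniform convergence in both variables at once; continuity and holomorphy in either variable
  follow by restricting to suitable compact sets.
\<close>

lemma even_factor_uniform_limit:
  assumes K: "compact K" "\<And>p. p \<in> K \<Longrightarrow> Im (fst p) > 0"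
  shows "uniform_limit K (\<lambda>N p. \<Prod>m<N. 1 - product_coef (fst p) m * snd p)
    (\<lambda>p. even_factor (fst p) (snd p)) sequentially"
proof (cases "K = {}")
  case False
  have c1: "continuous_on K (\<lambda>p. norm (nome (fst p)))"
    unfolding nome_def by (intro continuous_intros)
  obtain p1 where p1: "p1 \<in> K" "\<And>p. p \<in> K \<Longrightarrow> norm (nome (fst p)) \<le> norm (nome (fst p1))"
    using continuous_attains_sup[OF K(1) False c1] by blast
  have "compact (snd ` K)" using K by (intro compact_continuous_image continuous_intros)
  then obtain B where B: "\<And>p. p \<in> K \<Longrightarrow> norm (snd p) \<le> B"
    using compact_imp_bounded bounded_iff by (metis imageI)
  define r where "r = norm (nome (fst p1))"
  have r: "0 \<le> r" "r < 1" using norm_nome_less_1 K p1 by (auto simp: r_def)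
  have "uniformly_convergent_on K (\<lambda>N p. \<Sum>m<N. norm (- (product_coef (fst p) m * snd p)))"
  proof (rule Weierstrass_m_test')
    show "summable (\<lambda>m. r ^ Suc m / (1 - r)\<^sup>2 * B)" by (rule summable_coef_bound[OF r])
    show "norm (norm (- (product_coef (fst p) m * snd p))) \<le> r ^ Suc m / (1 - r)\<^sup>2 * B" if "p \<in> K" for m p
    proof -
      have "norm (product_coef (fst p) m) * norm (snd p) \<le> r ^ Suc m / (1 - r)\<^sup>2 * B"
        using norm_coef_le[of "fst p" r m] p1(2)[OF that] B[OF that] r
        by (intro mult_mono) (auto simp: r_def simp del: power_Suc)
      then show ?thesis by (simp add: norm_mult)
    qed
  qed
  then have "uniformly_convergent_on K (\<lambda>N p. \<Prod>m<N. 1 + - (product_coef (fst p) m * snd p))"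
  proof (intro uniformly_convergent_on_prod K)
    show "continuous_on K (\<lambda>p. - (product_coef (fst p) m * snd p))" for m
      using K(2) unfolding product_coef_def using one_minus_nome_power_nonzero unfolding nome_def
      by (intro continuous_intros) (auto simp del: power_Suc)
  qed
  then obtain l where l: "uniform_limit K (\<lambda>N p. \<Prod>m<N. 1 - product_coef (fst p) m * snd p) l sequentially"
    by (auto simp: uniformly_convergent_on_def)
  have "l p = even_factor (fst p) (snd p)" if "p \<in> K" for p
    using tendsto_uniform_limitI[OF l that] even_factor_limit[OF K(2)[OF that]] LIMSEQ_unique by blast
  then show ?thesis using l by (subst uniform_limit_cong') auto
qed auto

lemma continuous_on_even_factor:
  "continuous_on (upper_half_plane \<times> UNIV) (\<lambda>(\<tau>, w). even_factor \<tau> w)"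
proof (rule continuous_at_imp_continuous_on, rule ballI)
  fix p :: "complex \<times> complex" assume p: "p \<in> upper_half_plane \<times> UNIV"
  have "open (upper_half_plane \<times> (UNIV :: complex set))"
    unfolding upper_half_plane_def by (intro open_Times open_halfspace_Im_gt open_UNIV)
  then obtain r where r: "r > 0" "cball p r \<subseteq> upper_half_plane \<times> UNIV"
    using p open_contains_cball by blast
  have K: "Im (fst p') > 0" if "p' \<in> cball p r" for p'
    using r that by (auto simp: upper_half_plane_def)
  have "continuous_on (cball p r) (\<lambda>p. even_factor (fst p) (snd p))"
  proof (rule uniform_limit_theorem[OF _ even_factor_uniform_limit[OF compact_cball K]])
    show "\<forall>\<^sub>F n in sequentially. continuous_on (cball p r) (\<lambda>p. \<Prod>m<n. 1 - product_coef (fst p) m * snd p)"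
      unfolding product_coef_def using one_minus_nome_power_nonzero[OF K] unfolding nome_def
      by (intro always_eventually allI continuous_intros) (auto simp del: power_Suc)
  qed auto
  then have "continuous_on (ball p r) (\<lambda>(\<tau>, w). even_factor \<tau> w)"
    by (auto simp: case_prod_unfold intro: continuous_on_subset)
  then show "isCont (\<lambda>(\<tau>, w). even_factor \<tau> w) p"
    using r(1) continuous_on_eq_continuous_at[OF open_ball] centre_in_ball by blast
qed

lemma uniform_limit_precompose:
  assumes "uniform_limit (g ` A) f l F"
  shows "uniform_limit A (\<lambda>n x. f n (g x)) (\<lambda>x. l (g x)) F"
  using assms by (simp add: uniform_limit_iff)

lemma even_factor_has_derivative:
  assumes "Im \<tau> > 0"
  shows "\<exists>\<alpha> \<beta>. ((\<lambda>(\<tau>, w). even_factor \<tau> w) has_derivative (\<lambda>(s, t). \<alpha> * s + \<beta> * t)) (at (\<tau>, w))"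
proof (rule osgood[where S = "upper_half_plane \<times> UNIV"])
  have op: "open upper_half_plane" unfolding upper_half_plane_def by (rule open_halfspace_Im_gt)
  show "open (upper_half_plane \<times> (UNIV :: complex set))" using op by (intro open_Times) auto
  show "(\<tau>, w) \<in> upper_half_plane \<times> UNIV" using assms by (simp add: upper_half_plane_def)
  fix x y :: complex assume "(x, y) \<in> upper_half_plane \<times> UNIV"
  then have x: "x \<in> upper_half_plane" by simp
  have "(\<lambda>x. even_factor x y) holomorphic_on upper_half_plane"
  proof (rule holomorphic_uniform_sequence[OF op])
    show "(\<lambda>x. \<Prod>m<n. 1 - product_coef x m * y) holomorphic_on upper_half_plane" for n
      unfolding product_coef_def using one_minus_nome_power_nonzero unfolding nome_def
      by (intro holomorphic_intros) (auto simp: upper_half_plane_def simp del: power_Suc)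
    fix u assume "u \<in> upper_half_plane"
    then obtain d where d: "d > 0" "cball u d \<subseteq> upper_half_plane" using op open_contains_cball by blast
    have "uniform_limit ((\<lambda>x. (x, y)) ` cball u d) (\<lambda>N p. \<Prod>m<N. 1 - product_coef (fst p) m * snd p)
      (\<lambda>p. even_factor (fst p) (snd p)) sequentially"
      using d(2) by (intro even_factor_uniform_limit compact_continuous_image continuous_intros)
        (auto simp: upper_half_plane_def)
    from uniform_limit_precompose[OF this] d
    show "\<exists>d>0. cball u d \<subseteq> upper_half_plane \<and>
        uniform_limit (cball u d) (\<lambda>n x. \<Prod>m<n. 1 - product_coef x m * y) (\<lambda>x. even_factor x y) sequentially"
      by auto
  qed
  then show "(\<lambda>x. even_factor x y) field_differentiable at x"
    using op x holomorphic_on_imp_differentiable_at by blast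
  have "even_factor x holomorphic_on UNIV"
  proof (rule holomorphic_uniform_sequence[OF open_UNIV])
    show "(\<lambda>y. \<Prod>m<n. 1 - product_coef x m * y) holomorphic_on UNIV" for n
      by (intro holomorphic_intros)
    fix u :: complex
    have "uniform_limit ((\<lambda>y. (x, y)) ` cball u 1) (\<lambda>N p. \<Prod>m<N. 1 - product_coef (fst p) m * snd p)
      (\<lambda>p. even_factor (fst p) (snd p)) sequentially"
      using x by (intro even_factor_uniform_limit compact_continuous_image continuous_intros)
        (auto simp: upper_half_plane_def)
    from uniform_limit_precompose[OF this]
    show "\<exists>d>0. cball u d \<subseteq> UNIV \<and>
        uniform_limit (cball u d) (\<lambda>n y. \<Prod>m<n. 1 - product_coef x m * y) (even_factor x) sequentially"
      by (intro exI[of _ 1]) auto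
  qed
  then show "even_factor x field_differentiable at y"
    by (simp add: holomorphic_on_imp_differentiable_at)
qed (rule continuous_on_even_factor)

lemma two_sinh_holomorphic [holomorphic_intros]:
  "f holomorphic_on A \<Longrightarrow> (\<lambda>z. two_sinh (f z)) holomorphic_on A"
  unfolding two_sinh_def by (intro holomorphic_intros)

lemma even_factor_holomorphic: "Im \<tau> > 0 \<Longrightarrow> even_factor \<tau> holomorphic_on UNIV"
proof -
  assume \<tau>: "Im \<tau> > 0"
  have "(even_factor \<tau>) field_differentiable at w" for w
  proof -
    obtain \<alpha> \<beta> where D: "((\<lambda>(\<tau>, w). even_factor \<tau> w) has_derivative (\<lambda>(s, t). \<alpha> * s + \<beta> * t)) (at (\<tau>, w))"
      using even_factor_has_derivative[OF \<tau>] by blast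
    have "((\<lambda>w. (\<tau>, w)) has_derivative (\<lambda>t. (0, t))) (at w)"
      by (auto intro!: derivative_eq_intros)
    from diff_chain_at[OF this D] show ?thesis
      by (auto simp: o_def field_differentiable_def has_field_derivative_def)
  qed
  then show ?thesis by (simp add: holomorphic_on_def)
qed

lemma sigma_holomorphic: "Im \<tau> > 0 \<Longrightarrow> sigma \<tau> holomorphic_on A"
proof -
  assume \<tau>: "Im \<tau> > 0"
  have "(even_factor \<tau> \<circ> (\<lambda>z. (two_sinh z)\<^sup>2)) holomorphic_on UNIV"
    by (intro holomorphic_on_compose holomorphic_intros holomorphic_on_subset[OF even_factor_holomorphic[OF \<tau>]]) auto
  then have "(\<lambda>z. two_sinh z * even_factor \<tau> ((two_sinh z)\<^sup>2)) holomorphic_on UNIV"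
    by (intro holomorphic_intros) (auto simp: o_def)
  then show ?thesis
    by (metis (no_types, lifting) \<tau> holomorphic_cong holomorphic_on_subset sigma_eq subset_UNIV)
qed

section \<open>Quasi-periodicity and zeros\<close>

definition epi :: "complex \<Rightarrow> complex"
  where "epi x = exp (of_real pi * \<i> * x)"

lemma epi_add: "epi (x + y) = epi x * epi y"
  by (simp add: epi_def distrib_left exp_add)

lemma epi_nonzero [simp]: "epi x \<noteq> 0"
  by (simp add: epi_def)

lemma epi_0 [simp]: "epi 0 = 1"
  by (simp add: epi_def)

lemma epi_minus: "epi (- x) = inverse (epi x)"
  by (simp add: epi_def exp_minus)

lemma epi_1 [simp]: "epi 1 = - 1"
  by (simp add: epi_def)

lemma epi_even_int: "even k \<Longrightarrow> epi (of_int k) = 1"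
proof -
  assume "even k"
  then obtain j where "k = 2 * j" by blast
  then have "epi (of_int k) = exp (\<i> * (of_int j * (of_real pi * 2)))"
    by (simp add: epi_def mult_ac)
  also have "\<dots> = 1" by (rule exp_2pi_1_int)
  finally show ?thesis .
qed

lemma epi_odd_int: "odd k \<Longrightarrow> epi (of_int k) = - 1"
  using epi_even_int[of "k - 1"] epi_add[of "of_int (k - 1)" 1] by simp

lemma epi_cong_even:
  assumes "x - y = of_int k" "even k"
  shows "epi x = epi y"
  using epi_add[of y "of_int k"] epi_even_int[OF assms(2)] assms(1)
  by (simp add: algebra_simps)

lemma epi_holomorphic [holomorphic_intros]:
  "f holomorphic_on A \<Longrightarrow> (\<lambda>z. epi (f z)) holomorphic_on A"
  unfolding epi_def by (intro holomorphic_intros)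

lemma two_sinh_epi: "two_sinh z = epi z - epi (- z)"
  by (simp add: two_sinh_def epi_def)

lemma nome_epi: "nome \<tau> = epi \<tau> ^ 2"
  unfolding nome_def epi_def by (simp flip: exp_double add: mult_ac)

lemma exp_2pi_epi: "exp (2 * of_real pi * \<i> * z) = epi z ^ 2"
  unfolding epi_def by (simp flip: exp_double add: mult_ac)

lemma sigma_minus: "Im \<tau> > 0 \<Longrightarrow> sigma \<tau> (- z) = - sigma \<tau> z"
proof -
  have "two_sinh (- z) = - two_sinh z" by (simp add: two_sinh_epi)
  then show "Im \<tau> > 0 \<Longrightarrow> ?thesis" by (simp add: sigma_eq)
qed

lemma sigma_plus_1: "Im \<tau> > 0 \<Longrightarrow> sigma \<tau> (z + 1) = - sigma \<tau> z"
proof -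
  have "two_sinh (z + 1) = - two_sinh z"
    using epi_add[of z 1] epi_minus[of "z + 1"] epi_minus[of z] by (simp add: two_sinh_epi)
  then show "Im \<tau> > 0 \<Longrightarrow> ?thesis" by (simp add: sigma_eq)
qed

lemma sigma_partial_products:
  assumes "Im \<tau> > 0"
  shows "(\<lambda>N. \<Prod>m<N. (1 - nome \<tau> ^ Suc m * (epi z)\<^sup>2) * (1 - nome \<tau> ^ Suc m * inverse ((epi z)\<^sup>2)) /
            (1 - nome \<tau> ^ Suc m)\<^sup>2) \<longlonglongrightarrow> even_factor \<tau> ((two_sinh z)\<^sup>2)"
  using even_factor_limit[OF assms, of "(two_sinh z)\<^sup>2"]
  by (simp add: sigma_factor_eq[OF assms exp_2pi_epi[symmetric]] del: power_Suc)

text \<open>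
  Replacing \<open>y\<close> by \<open>q y\<close> moves every factor to its neighbour, so that the two partial products differ
  only in their end factors. Cross-multiplied, the identity also holds at the zeros of these factors.
\<close>

lemma partial_product_shift:
  fixes q y :: complex
  assumes "y \<noteq> 0" "q \<noteq> 0"
  shows "(\<Prod>m<N. (1 - q ^ Suc m * (q * y)) * (1 - q ^ Suc m * inverse (q * y)) / D m) *
           ((1 - q * y) * (1 - q ^ N * inverse y)) =
         (\<Prod>m<N. (1 - q ^ Suc m * y) * (1 - q ^ Suc m * inverse y) / D m) *
           ((1 - q ^ Suc N * y) * (1 - inverse y))"
proof (induction N)
  case (Suc N)
  define P where "P = (\<Prod>m<N. (1 - q ^ Suc m * (q * y)) * (1 - q ^ Suc m * inverse (q * y)) / D m)"
  define P' where "P' = (\<Prod>m<N. (1 - q ^ Suc m * y) * (1 - q ^ Suc m * inverse y) / D m)"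
  have IH: "P * ((1 - q * y) * (1 - q ^ N * inverse y)) = P' * ((1 - q ^ Suc N * y) * (1 - inverse y))"
    using Suc by (simp add: P_def P'_def)
  have e: "q ^ Suc N * inverse (q * y) = q ^ N * inverse y" "q ^ Suc N * (q * y) = q ^ Suc (Suc N) * y"
    using assms by (simp_all add: field_simps)
  have "P * ((1 - q ^ Suc (Suc N) * y) * (1 - q ^ N * inverse y) / D N) * ((1 - q * y) * (1 - q ^ Suc N * inverse y))
     = (P * ((1 - q * y) * (1 - q ^ N * inverse y))) * ((1 - q ^ Suc (Suc N) * y) * (1 - q ^ Suc N * inverse y) / D N)"
    by (simp add: mult_ac)
  also have "\<dots> = P' * ((1 - q ^ Suc N * y) * (1 - q ^ Suc N * inverse y) / D N) *
      ((1 - q ^ Suc (Suc N) * y) * (1 - inverse y))"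
    unfolding IH by (simp add: mult_ac)
  finally show ?case
    unfolding prod.lessThan_Suc P_def[symmetric] P'_def[symmetric] e .
qed simp

lemma sigma_plus_tau:
  assumes \<tau>: "Im \<tau> > 0"
  shows "sigma \<tau> (z + \<tau>) = epi (1 - \<tau> - 2 * z) * sigma \<tau> z"
proof -
  define q where "q = nome \<tau>"
  define y where "y = (epi z)\<^sup>2"
  have qy: "(epi (z + \<tau>))\<^sup>2 = q * y"
    by (simp add: q_def y_def nome_epi epi_add power_mult_distrib)
  have q0: "(\<lambda>N. q ^ N) \<longlonglongrightarrow> 0"
    using norm_nome_less_1[OF \<tau>] by (auto simp: q_def intro: LIMSEQ_power_zero)
  define P where "P = even_factor \<tau> ((two_sinh z)\<^sup>2)"
  define P' where "P' = even_factor \<tau> ((two_sinh (z + \<tau>))\<^sup>2)"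
  have y0: "y \<noteq> 0" "q \<noteq> 0" by (simp_all add: y_def q_def)
  have "(\<lambda>N. (\<Prod>m<N. (1 - q ^ Suc m * (q * y)) * (1 - q ^ Suc m * inverse (q * y)) / (1 - q ^ Suc m)\<^sup>2) *
           ((1 - q * y) * (1 - q ^ N * inverse y))) \<longlonglongrightarrow> P' * ((1 - q * y) * (1 - 0 * inverse y))"
    using sigma_partial_products[OF \<tau>, of "z + \<tau>"] unfolding qy q_def[symmetric] P'_def[symmetric]
    by (intro tendsto_intros q0)
  moreover have "(\<lambda>N. (\<Prod>m<N. (1 - q ^ Suc m * y) * (1 - q ^ Suc m * inverse y) / (1 - q ^ Suc m)\<^sup>2) *
           ((1 - q ^ Suc N * y) * (1 - inverse y))) \<longlonglongrightarrow> P * ((1 - 0 * y) * (1 - inverse y))"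
    using sigma_partial_products[OF \<tau>, of z] unfolding y_def[symmetric] q_def[symmetric] P_def[symmetric]
    by (intro tendsto_intros LIMSEQ_Suc[OF q0])
  ultimately have PP: "P' * (1 - q * y) = P * (1 - inverse y)"
    unfolding partial_product_shift[OF y0] using LIMSEQ_unique by fastforce
  define a b where "a = epi z" and "b = epi \<tau>"
  have nz: "a \<noteq> 0" "b \<noteq> 0" by (simp_all add: a_def b_def)
  have t1: "two_sinh (z + \<tau>) = - inverse (a * b) * (1 - q * y)"
    using nz unfolding two_sinh_epi epi_minus epi_add nome_epi q_def y_def a_def[symmetric] b_def[symmetric]
    by (simp add: field_simps power2_eq_square)
  have t2: "two_sinh z = a * (1 - inverse y)"
    using nz unfolding two_sinh_epi epi_minus y_def a_def[symmetric]
    by (simp add: field_simps power2_eq_square)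
  have t3: "epi (1 - \<tau> - 2 * z) = - inverse b * inverse (a ^ 2)"
  proof -
    have "1 - \<tau> - 2 * z = 1 + (- \<tau>) + (- z) + (- z)" by simp
    then have "epi (1 - \<tau> - 2 * z) = epi (1 + (- \<tau>) + (- z) + (- z))" by (rule arg_cong)
    also have "\<dots> = - inverse b * inverse (a ^ 2)"
      unfolding epi_add epi_minus a_def b_def epi_1 by (simp add: power2_eq_square)
    finally show ?thesis .
  qed
  have "sigma \<tau> (z + \<tau>) = - inverse (a * b) * (P' * (1 - q * y))"
  proof -
    have "sigma \<tau> (z + \<tau>) = two_sinh (z + \<tau>) * P'" by (simp add: sigma_eq[OF \<tau>] P'_def)
    then show ?thesis by (simp only: t1 mult_ac)
  qed
  also have "\<dots> = epi (1 - \<tau> - 2 * z) * (two_sinh z * P)"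
    unfolding PP t3 t2 using nz by (simp add: field_simps power2_eq_square)
  finally show ?thesis by (simp add: sigma_eq[OF \<tau>] P_def)
qed

text \<open>
  Transformation under a step is equivalent to transformation under its inverse, so one equivalence
  serves both directions of an induction over the integers.
\<close>

lemma int_all_from_0:
  fixes P :: "int \<Rightarrow> bool"
  assumes "P 0" "\<And>i. P i \<longleftrightarrow> P (i + 1)"
  shows "P i"
proof (induction i rule: int_induct[where k = 0])
  case (step2 i)
  then show ?case using assms(2)[of "i - 1"] by simp
qed (use assms in auto)

text \<open>
  The signs are written as values of \<open>epi\<close> at integers, which turns the multiplier into a single
  exponential; its exponent matters only modulo 2.
\<close>

theorem sigma_quasi_periodic:
  assumes \<tau>: "Im \<tau> > 0"
  shows "sigma \<tau> (z + of_int m + of_int n * \<tau>) =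
    epi (of_int m + of_int n - of_int n ^ 2 * \<tau> - 2 * of_int n * z) * sigma \<tau> z"
proof -
  have 1: "\<forall>z. sigma \<tau> (z + of_int m) = epi (of_int m) * sigma \<tau> z" for m
  proof (rule int_all_from_0[of "\<lambda>m. \<forall>z. sigma \<tau> (z + of_int m) = epi (of_int m) * sigma \<tau> z"])
    fix m :: int
    show "(\<forall>z. sigma \<tau> (z + of_int m) = epi (of_int m) * sigma \<tau> z) \<longleftrightarrow>
      (\<forall>z. sigma \<tau> (z + of_int (m + 1)) = epi (of_int (m + 1)) * sigma \<tau> z)"
      using sigma_plus_1[OF \<tau>, of "z + of_int m" for z] by (simp add: epi_add add.assoc)
  qed auto
  have 2: "\<forall>z. sigma \<tau> (z + of_int n * \<tau>) = epi (of_int n - of_int n ^ 2 * \<tau> - 2 * of_int n * z) * sigma \<tau> z" for n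
  proof (rule int_all_from_0[of "\<lambda>n. \<forall>z. sigma \<tau> (z + of_int n * \<tau>) =
        epi (of_int n - of_int n ^ 2 * \<tau> - 2 * of_int n * z) * sigma \<tau> z"])
    fix n :: int
    have a: "sigma \<tau> (z + of_int (n + 1) * \<tau>) = epi (1 - \<tau> - 2 * (z + of_int n * \<tau>)) * sigma \<tau> (z + of_int n * \<tau>)" for z
      using sigma_plus_tau[OF \<tau>, of "z + of_int n * \<tau>"] by (simp add: algebra_simps)
    have b: "epi (of_int (n + 1) - of_int (n + 1) ^ 2 * \<tau> - 2 * of_int (n + 1) * z) =
        epi (1 - \<tau> - 2 * (z + of_int n * \<tau>)) * epi (of_int n - of_int n ^ 2 * \<tau> - 2 * of_int n * z)" for z
      unfolding epi_add[symmetric] by (rule arg_cong[of _ _ epi]) (simp add: algebra_simps power2_eq_square)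
    show "(\<forall>z. sigma \<tau> (z + of_int n * \<tau>) = epi (of_int n - of_int n ^ 2 * \<tau> - 2 * of_int n * z) * sigma \<tau> z) \<longleftrightarrow>
      (\<forall>z. sigma \<tau> (z + of_int (n + 1) * \<tau>) =
        epi (of_int (n + 1) - of_int (n + 1) ^ 2 * \<tau> - 2 * of_int (n + 1) * z) * sigma \<tau> z)"
      unfolding a b by simp
  qed auto
  have "sigma \<tau> (z + of_int m + of_int n * \<tau>) =
      epi (of_int n - of_int n ^ 2 * \<tau> - 2 * of_int n * (z + of_int m)) * (epi (of_int m) * sigma \<tau> z)"
    using 1[rule_format, of z m] 2[rule_format, of "z + of_int m" n] by simp
  also have "epi (of_int n - of_int n ^ 2 * \<tau> - 2 * of_int n * (z + of_int m)) =
      epi (of_int n - of_int n ^ 2 * \<tau> - 2 * of_int n * z)"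
    by (rule epi_cong_even[of _ _ "- 2 * n * m"]) (simp_all add: algebra_simps)
  finally show ?thesis
    using epi_add[of "of_int m" "of_int n - of_int n ^ 2 * \<tau> - 2 * of_int n * z"]
    by (simp add: algebra_simps)
qed

lemma two_sinh_0 [simp]: "two_sinh 0 = 0"
  by (simp add: two_sinh_def)

lemma sigma_0: "Im \<tau> > 0 \<Longrightarrow> sigma \<tau> 0 = 0"
  by (simp add: sigma_eq)

lemma epi_square_eq_1: "(epi x)\<^sup>2 = 1 \<Longrightarrow> \<exists>k::int. x = of_int k"
proof -
  assume "(epi x)\<^sup>2 = 1"
  then have "exp (2 * of_real pi * \<i> * x) = 1" by (simp add: exp_2pi_epi)
  then obtain k :: int where k: "Re (2 * of_real pi * \<i> * x) = 0" "Im (2 * of_real pi * \<i> * x) = of_int (2 * k) * pi"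
    unfolding exp_eq_1 by blast
  have "Im x = 0" using k(1) by simp
  moreover have "Re x = of_int k" using k(2) by (simp add: mult.commute)
  ultimately have "x = of_int k" by (intro complex_eqI) simp_all
  then show ?thesis by blast
qed

text \<open>
  The sine factor vanishes at the integers and the factors of the product at \<open>z \<equiv> \<plusminus>m \<tau>\<close> modulo \<open>\<int>\<close> for
  \<open>m > 0\<close>; together these are exactly the lattice points.
\<close>

theorem sigma_eq_0_iff:
  assumes \<tau>: "Im \<tau> > 0"
  shows "sigma \<tau> z = 0 \<longleftrightarrow> (\<exists>m n :: int. z = of_int m + of_int n * \<tau>)"
proof
  assume "\<exists>m n :: int. z = of_int m + of_int n * \<tau>"
  then show "sigma \<tau> z = 0"
    using sigma_quasi_periodic[OF \<tau>, of 0] sigma_0[OF \<tau>] by auto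
next
  assume "sigma \<tau> z = 0"
  then consider "two_sinh z = 0" | m where "product_coef \<tau> m * (two_sinh z)\<^sup>2 = 1"
    using sigma_eq[OF \<tau>] even_factor_eq_0_iff[OF \<tau>] by auto
  then show "\<exists>m n :: int. z = of_int m + of_int n * \<tau>"
  proof cases
    case 1
    then have "(epi z)\<^sup>2 = 1"
      by (simp add: two_sinh_epi epi_minus power2_eq_square field_simps)
    from epi_square_eq_1[OF this] show ?thesis by (metis add.right_neutral mult_zero_left of_int_0)
  next
    case (2 m)
    then have "(1 - nome \<tau> ^ Suc m * (epi z)\<^sup>2) * (1 - nome \<tau> ^ Suc m * inverse ((epi z)\<^sup>2)) = 0"
      using sigma_factor_eq[OF \<tau> exp_2pi_epi[symmetric], of m z] one_minus_nome_power_nonzero[OF \<tau>, of m]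
      by (simp del: power_Suc)
    moreover have "nome \<tau> ^ Suc m = (epi (of_nat (Suc m) * \<tau>))\<^sup>2"
      unfolding nome_def exp_2pi_epi[symmetric] by (simp flip: exp_of_nat_mult add: mult_ac del: power_Suc of_nat_Suc)
    ultimately have "(epi (of_nat (Suc m) * \<tau> + z))\<^sup>2 = 1 \<or> (epi (of_nat (Suc m) * \<tau> - z))\<^sup>2 = 1"
      using epi_add[of "of_nat (Suc m) * \<tau>" z] epi_add[of "of_nat (Suc m) * \<tau>" "- z"]
      by (auto simp: epi_minus power_mult_distrib power_inverse simp del: of_nat_Suc power_Suc)
    then show ?thesis
    proof
      assume "(epi (of_nat (Suc m) * \<tau> + z))\<^sup>2 = 1"
      then obtain k :: int where "of_nat (Suc m) * \<tau> + z = of_int k" using epi_square_eq_1 by blast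
      then have "z = of_int k + of_int (- int (Suc m)) * \<tau>" by (simp add: algebra_simps)
      then show ?thesis by blast
    next
      assume "(epi (of_nat (Suc m) * \<tau> - z))\<^sup>2 = 1"
      then obtain k :: int where "of_nat (Suc m) * \<tau> - z = of_int k" using epi_square_eq_1 by blast
      then have "z = of_int (- k) + of_int (int (Suc m)) * \<tau>" by (simp add: algebra_simps)
      then show ?thesis by blast
    qed
  qed
qed

lemma sigma_half_nonzero:
  assumes "Im \<tau> > 0"
  shows "sigma \<tau> (1 / 2) \<noteq> 0"
proof
  assume "sigma \<tau> (1 / 2) = 0"
  then obtain m n :: int where mn: "1 / 2 = of_int m + of_int n * \<tau>"
    using sigma_eq_0_iff[OF assms] by blast
  have "0 = real_of_int n * Im \<tau>" using arg_cong[OF mn, of Im] by simp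
  then have "n = 0" using assms by simp
  then have "2 * real_of_int m = 1" using arg_cong[OF mn, of Re] by simp
  then have "2 * m = 1" by linarith
  then show False by presburger
qed

lemma sigma_eventually_nonzero:
  assumes "Im \<tau> > 0"
  shows "\<forall>\<^sub>F w in at z. sigma \<tau> w \<noteq> 0"
  using non_zero_neighbour_alt[OF sigma_holomorphic[OF assms, of UNIV] _ _ _ _ sigma_half_nonzero[OF assms]]
  by (auto elim: eventually_mono)

lemma countable_sigma_zeros:
  assumes "Im \<tau> > 0"
  shows "countable {z. sigma \<tau> z = 0}"
proof -
  have "{z. sigma \<tau> z = 0} = (\<lambda>(m, n). of_int m + of_int n * \<tau>) ` (UNIV :: (int \<times> int) set)"
    using sigma_eq_0_iff[OF assms] by auto
  then show ?thesis by simp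
qed

section \<open>The modular transformation law\<close>

lemma sigma_has_derivative_0:
  assumes "Im \<tau> > 0"
  shows "(sigma \<tau> has_field_derivative 2 * of_real pi * \<i>) (at 0)"
proof -
  have "(even_factor \<tau> \<circ> (\<lambda>z. (two_sinh z)\<^sup>2)) holomorphic_on UNIV"
    by (intro holomorphic_on_compose holomorphic_intros holomorphic_on_subset[OF even_factor_holomorphic[OF assms]]) auto
  then obtain D where D: "((\<lambda>z. even_factor \<tau> ((two_sinh z)\<^sup>2)) has_field_derivative D) (at 0)"
    by (auto simp: o_def holomorphic_on_def field_differentiable_def)
  have "(two_sinh has_field_derivative 2 * of_real pi * \<i>) (at 0)"
    unfolding two_sinh_def[abs_def] by (auto intro!: derivative_eq_intros)
  from DERIV_mult[OF this D] have
    "((\<lambda>z. two_sinh z * even_factor \<tau> ((two_sinh z)\<^sup>2)) has_field_derivative 2 * of_real pi * \<i> * even_factor \<tau> 0) (at 0)"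
    by simp
  moreover have "even_factor \<tau> 0 = 1" by (simp add: even_factor_def)
  moreover have "sigma \<tau> = (\<lambda>z. two_sinh z * even_factor \<tau> ((two_sinh z)\<^sup>2))"
    using sigma_eq[OF assms] by blast
  ultimately show ?thesis by simp
qed

lemma doubly_periodic_shift:
  fixes h :: "complex \<Rightarrow> 'a"
  assumes "\<And>z. h (z + 1) = h z" "\<And>z. h (z + \<tau>) = h z"
  shows "h (z + of_int m + of_int n * \<tau>) = h z"
proof -
  have 1: "\<forall>z. h (z + of_int m) = h z" for m
  proof (rule int_all_from_0[of "\<lambda>m. \<forall>z. h (z + of_int m) = h z"])
    show "(\<forall>z. h (z + of_int i) = h z) \<longleftrightarrow> (\<forall>z. h (z + of_int (i + 1)) = h z)" for i
      using assms(1)[of "z + of_int i" for z] by (simp add: add.assoc)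
  qed auto
  have 2: "\<forall>z. h (z + of_int n * \<tau>) = h z" for n
  proof (rule int_all_from_0[of "\<lambda>n. \<forall>z. h (z + of_int n * \<tau>) = h z"])
    show "(\<forall>z. h (z + of_int i * \<tau>) = h z) \<longleftrightarrow> (\<forall>z. h (z + of_int (i + 1) * \<tau>) = h z)" for i
      using assms(2)[of "z + of_int i * \<tau>" for z] by (simp add: algebra_simps)
  qed auto
  show ?thesis using 1 2 by simp
qed

text \<open>
  All values are attained on a closed period parallelogram, which is compact, so Liouville's theorem
  applies.
\<close>

lemma entire_doubly_periodic_constant:
  assumes \<tau>: "Im \<tau> > 0" and h: "h holomorphic_on UNIV"
    and per: "\<And>z. h (z + 1) = h z" "\<And>z. h (z + \<tau>) = h z"
  shows "h z = h w"
proof -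
  define K where "K = (\<lambda>(s, t). of_real s + of_real t * \<tau>) ` ({0..1} \<times> {0..1::real})"
  have "compact K" unfolding K_def case_prod_unfold
    by (intro compact_continuous_image compact_Times continuous_intros) auto
  then have "compact (h ` K)"
    using h by (intro compact_continuous_image) (auto intro: holomorphic_on_imp_continuous_on holomorphic_on_subset)
  moreover have "range h \<subseteq> h ` K"
  proof
    fix x assume "x \<in> range h"
    then obtain z where x: "x = h z" by blast
    define t where "t = Im z / Im \<tau>"
    define s where "s = Re z - t * Re \<tau>"
    have z: "z = of_real s + of_real t * \<tau>"
      using \<tau> by (simp add: s_def t_def complex_eq_iff)
    define z' where "z' = of_real (frac s) + of_real (frac t) * \<tau>"
    have "z = z' + of_int \<lfloor>s\<rfloor> + of_int \<lfloor>t\<rfloor> * \<tau>"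
      unfolding z'_def by (subst z) (simp add: frac_def algebra_simps)
    then have "h z = h z'" using doubly_periodic_shift[of h, OF per] by simp
    moreover have "z' \<in> K"
      unfolding z'_def K_def using frac_lt_1 frac_ge_0 less_imp_le by (intro image_eqI[of _ _ "(frac s, frac t)"]) auto
    ultimately show "x \<in> h ` K" using x by auto
  qed
  ultimately have "bounded (range h)" using bounded_subset compact_imp_bounded by blast
  from Liouville_theorem[OF h this] show ?thesis by (auto simp: constant_on_def)
qed

text \<open>
  The argument treats an arbitrary matrix at once. Correct the left-hand side by the exponential of the
  quadratic term. The result \<open>N\<close> has the same quasi-periods as \<open>sigma \<tau>\<close>, because both lattices agree
  up to the factor \<open>u\<close>, and the same simple zeros. So \<open>N / sigma \<tau>\<close> extends to an entire doubly
  periodic function, which is constant. The denominators \<open>(1 - q\<^sup>m)\<^sup>2\<close> normalise \<open>sigma\<close> to have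
  derivative \<open>2 \<pi> \<i>\<close> at 0 for every \<open>\<tau>\<close>, so this constant is 1.
\<close>

theorem sigma_modular:
  fixes a b c d :: int
  assumes \<tau>: "Im \<tau> > 0" and det: "a * d - b * c = 1"
  defines "u \<equiv> of_int c * \<tau> + of_int d"
  defines "\<tau>' \<equiv> (of_int a * \<tau> + of_int b) / u"
  assumes \<tau>': "Im \<tau>' > 0" and u: "u \<noteq> 0"
  shows "sigma \<tau>' (z / u) = epi (of_int c * z\<^sup>2 / u) / u * sigma \<tau> z"
proof -
  define N where "N = (\<lambda>z. sigma \<tau>' (z / u) * u * epi (- (of_int c * z\<^sup>2 / u)))"
  have ta: "\<tau>' * u = of_int a * \<tau> + of_int b" using u by (simp add: \<tau>'_def)
  have detC: "of_int a * of_int d - of_int b * of_int c = (1 :: complex)"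
    using det by (metis of_int_1 of_int_diff of_int_mult)
  have lat: "(of_int m + of_int n * \<tau>) / u = of_int (a * m - b * n) + of_int (d * n - c * m) * \<tau>'" for m n
  proof -
    have "(of_int (a * m - b * n) + of_int (d * n - c * m) * \<tau>') * u =
        of_int (a * m - b * n) * u + of_int (d * n - c * m) * (of_int a * \<tau> + of_int b)"
      unfolding ta[symmetric] by (simp add: algebra_simps)
    also have "\<dots> = (of_int a * of_int d - of_int b * of_int c) * (of_int m + of_int n * \<tau>)"
      by (simp add: u_def algebra_simps)
    finally show ?thesis using u detC by (simp add: field_simps)
  qed
  \<comment> \<open>A row or column of a unimodular matrix is not even, so \<open>(1 + a)(1 + c)\<close> and \<open>(1 + b)(1 + d)\<close> are even.\<close>
  have par1: "odd (a + c + a * c)" "odd (b + d + b * d)"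
  proof -
    have "even a \<and> even c \<longrightarrow> False" "even b \<and> even d \<longrightarrow> False"
      using det by (metis dvd_diff dvd_mult dvd_mult2 odd_one)+
    then show "odd (a + c + a * c)" "odd (b + d + b * d)" by auto
  qed
  have N1: "N (z + 1) = - N z" for z
  proof -
    have l: "(z + 1) / u = z / u + of_int a + of_int (- c) * \<tau>'"
      using lat[of 1 0] by (simp add: add_divide_distrib)
    have e: "of_int a + of_int (- c) - of_int (- c) ^ 2 * \<tau>' - 2 * of_int (- c) * (z / u)
        + (- (of_int c * (z + 1)\<^sup>2 / u)) = - (of_int c * z\<^sup>2 / u) + of_int (a - c - a * c)"
    proof -
      have "of_int c ^ 2 * \<tau>' + of_int c / u = of_int (a * c)"
      proof -
        have "(of_int c ^ 2 * \<tau>' + of_int c / u) * u = of_int c ^ 2 * (\<tau>' * u) + of_int c"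
          using u by (simp add: algebra_simps)
        also have "\<dots> = of_int (a * c) * u"
          unfolding ta unfolding u_def of_int_mult using detC by algebra
        finally show ?thesis using u by simp
      qed
      then show ?thesis
        unfolding divide_inverse of_int_minus of_int_diff of_int_mult of_int_1 by algebra
    qed
    have "N (z + 1) = epi (of_int a + of_int (- c) - of_int (- c) ^ 2 * \<tau>' - 2 * of_int (- c) * (z / u)
        + (- (of_int c * (z + 1)\<^sup>2 / u))) * sigma \<tau>' (z / u) * u"
      unfolding N_def l sigma_quasi_periodic[OF \<tau>'] epi_add by (simp add: mult_ac)
    also have "epi (of_int a + of_int (- c) - of_int (- c) ^ 2 * \<tau>' - 2 * of_int (- c) * (z / u)
        + (- (of_int c * (z + 1)\<^sup>2 / u))) = - epi (- (of_int c * z\<^sup>2 / u))"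
      unfolding e epi_add[of _ "of_int (a - c - a * c)"]
      using epi_odd_int[of "a - c - a * c"] par1 by simp
    finally show ?thesis by (simp add: N_def)
  qed
  have N2: "N (z + \<tau>) = epi (1 - \<tau> - 2 * z) * N z" for z
  proof -
    have l: "(z + \<tau>) / u = z / u + of_int (- b) + of_int d * \<tau>'"
      using lat[of 0 1] by (simp add: add_divide_distrib)
    have e: "of_int (- b) + of_int d - of_int d ^ 2 * \<tau>' - 2 * of_int d * (z / u)
        + (- (of_int c * (z + \<tau>)\<^sup>2 / u)) = (1 - \<tau> - 2 * z) + (- (of_int c * z\<^sup>2 / u)) + of_int (d - b - b * d - 1)"
    proof -
      have "of_int d ^ 2 * \<tau>' + 2 * of_int d * (z / u) + of_int c * (2 * z * \<tau> + \<tau>\<^sup>2) / u = of_int (b * d) + \<tau> + 2 * z"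
      proof -
        have "(of_int d ^ 2 * \<tau>' + 2 * of_int d * (z / u) + of_int c * (2 * z * \<tau> + \<tau>\<^sup>2) / u) * u
          = of_int d ^ 2 * (\<tau>' * u) + 2 * of_int d * z + of_int c * (2 * z * \<tau> + \<tau>\<^sup>2)"
          unfolding divide_inverse using right_inverse[OF u] by algebra
        also have "\<dots> = (of_int (b * d) + \<tau> + 2 * z) * u"
          unfolding ta unfolding u_def of_int_mult using detC by algebra
        finally show ?thesis using u by simp
      qed
      then show ?thesis
        unfolding divide_inverse of_int_minus of_int_diff of_int_mult of_int_1 by algebra
    qed
    have "N (z + \<tau>) = epi (of_int (- b) + of_int d - of_int d ^ 2 * \<tau>' - 2 * of_int d * (z / u)
        + (- (of_int c * (z + \<tau>)\<^sup>2 / u))) * sigma \<tau>' (z / u) * u"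
      unfolding N_def l sigma_quasi_periodic[OF \<tau>'] epi_add by (simp add: mult_ac)
    also have "epi (of_int (- b) + of_int d - of_int d ^ 2 * \<tau>' - 2 * of_int d * (z / u)
        + (- (of_int c * (z + \<tau>)\<^sup>2 / u))) = epi (1 - \<tau> - 2 * z) * epi (- (of_int c * z\<^sup>2 / u))"
      unfolding e epi_add[of _ "of_int (d - b - b * d - 1)"]
    proof -
      have "even (d - b - b * d - 1)" using par1(2) by simp blast
      then have "epi (of_int (d - b - b * d - 1)) = 1" by (rule epi_even_int)
      then show "epi (1 - \<tau> - 2 * z + - (of_int c * z\<^sup>2 / u)) * epi (of_int (d - b - b * d - 1)) =
          epi (1 - \<tau> - 2 * z) * epi (- (of_int c * z\<^sup>2 / u))"
        by (simp only: epi_add mult_1_right)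
    qed
    finally show ?thesis by (simp only: N_def mult_ac)
  qed
  have Nhol: "N holomorphic_on UNIV"
  proof -
    have "(sigma \<tau>' \<circ> (\<lambda>z. z / u)) holomorphic_on UNIV"
      using u by (intro holomorphic_on_compose holomorphic_intros sigma_holomorphic \<tau>') auto
    then show ?thesis
      unfolding N_def using u by (intro holomorphic_intros) (auto simp: o_def)
  qed
  \<comment> \<open>The value 1 at lattice points is the limit of the quotient, as both derivatives at 0 agree.\<close>
  define h where "h = (\<lambda>z. if sigma \<tau> z = 0 then 1 else N z / sigma \<tau> z)"
  have h1: "h (z + 1) = h z" for z
    unfolding h_def N1 sigma_plus_1[OF \<tau>] by simp
  have h2: "h (z + \<tau>) = h z" for z
    unfolding h_def N2 sigma_plus_tau[OF \<tau>] by simp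
  have N0: "N 0 = 0" using sigma_0[OF \<tau>'] by (simp add: N_def)
  have "((\<lambda>z. sigma \<tau>' (z / u)) has_field_derivative 2 * of_real pi * \<i> * (1 / u)) (at 0)"
    by (rule DERIV_chain2[of "sigma \<tau>'"]) (use sigma_has_derivative_0[OF \<tau>'] u in \<open>auto intro!: derivative_eq_intros\<close>)
  moreover have "((\<lambda>z. u * epi (- (of_int c * z\<^sup>2 / u))) has_field_derivative 0) (at 0)"
    unfolding epi_def using u by (auto intro!: derivative_eq_intros)
  ultimately have "((\<lambda>z. sigma \<tau>' (z / u) * (u * epi (- (of_int c * z\<^sup>2 / u)))) has_field_derivative
      2 * of_real pi * \<i> * (1 / u) * (u * epi (- (of_int c * 0\<^sup>2 / u))) + 0 * sigma \<tau>' (0 / u)) (at 0)"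
    by (rule DERIV_mult)
  then have N': "(N has_field_derivative 2 * of_real pi * \<i>) (at 0)"
    unfolding N_def using u by (simp add: mult.assoc)
  have lim: "h \<midarrow>0\<rightarrow> 1"
  proof -
    have "((\<lambda>z. N z / z) \<longlongrightarrow> 2 * of_real pi * \<i>) (at 0)" "((\<lambda>z. sigma \<tau> z / z) \<longlongrightarrow> 2 * of_real pi * \<i>) (at 0)"
      using N' sigma_has_derivative_0[OF \<tau>] N0 sigma_0[OF \<tau>] by (auto simp: has_field_derivative_iff)
    then have "((\<lambda>z. (N z / z) / (sigma \<tau> z / z)) \<longlongrightarrow> (2 * of_real pi * \<i>) / (2 * of_real pi * \<i>)) (at 0)"
      by (intro tendsto_divide) auto
    moreover have "\<forall>\<^sub>F z in at 0. (N z / z) / (sigma \<tau> z / z) = h z"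
      using sigma_eventually_nonzero[OF \<tau>, of 0] eventually_neq_at_within[of 0]
      by eventually_elim (auto simp: h_def)
    ultimately show ?thesis by (auto elim: Lim_transform_eventually)
  qed
  have h0: "h 0 = 1" by (simp add: h_def sigma_0[OF \<tau>])
  have cont0: "isCont h 0" using lim h0 by (simp add: isCont_def)
  have off: "h field_differentiable at w" if w: "sigma \<tau> w \<noteq> 0" for w
  proof -
    have "open {z. sigma \<tau> z \<noteq> 0}"
      using sigma_holomorphic[OF \<tau>, of UNIV] by (intro open_Collect_neq) (auto intro: holomorphic_on_imp_continuous_on)
    moreover have "(\<lambda>z. N z / sigma \<tau> z) holomorphic_on {z. sigma \<tau> z \<noteq> 0}"
      by (intro holomorphic_intros holomorphic_on_subset[OF Nhol] sigma_holomorphic[OF \<tau>]) auto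
    then have "h holomorphic_on {z. sigma \<tau> z \<noteq> 0}"
      by (rule holomorphic_transform) (simp add: h_def)
    ultimately show ?thesis using w holomorphic_on_imp_differentiable_at by blast
  qed
  have at0: "h field_differentiable at 0"
  proof -
    obtain r where r: "r > 0" "\<And>w. w \<in> ball 0 r \<Longrightarrow> w \<noteq> 0 \<Longrightarrow> sigma \<tau> w \<noteq> 0"
      using sigma_eventually_nonzero[OF \<tau>, of 0] unfolding eventually_at by (auto simp: dist_commute)
    have "h holomorphic_on ball 0 r"
    proof (rule no_isolated_singularity[of _ _ "{0}"])
      show "h holomorphic_on ball 0 r - {0}"
        using off r(2) by (auto simp: holomorphic_on_def intro: field_differentiable_at_within)
      show "continuous_on (ball 0 r) h"
      proof (intro continuous_at_imp_continuous_on ballI)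
        fix w :: complex assume "w \<in> ball 0 r"
        then have "w = 0 \<or> h field_differentiable at w" using off r(2) by blast
        then show "isCont h w"
          using cont0 field_differentiable_imp_continuous_at by blast
      qed
    qed auto
    then show ?thesis using r(1) by (auto intro: holomorphic_on_imp_differentiable_at[of _ "ball 0 r"])
  qed
  have hhol: "h holomorphic_on UNIV"
  proof -
    have "h field_differentiable at w" for w
    proof (cases "sigma \<tau> w = 0")
      case True
      then obtain m n :: int where w: "w = of_int m + of_int n * \<tau>" using sigma_eq_0_iff[OF \<tau>] by blast
      have "h = (\<lambda>z. h (z - w))"
        using doubly_periodic_shift[of h \<tau>, OF h1 h2, of "z - w" m n for z] by (auto simp: w fun_eq_iff algebra_simps)
      moreover have "(\<lambda>z. h (z - w)) field_differentiable at w"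
        using field_differentiable_compose[of "\<lambda>z. z - w" w h] at0
        by (simp add: o_def field_differentiable_diff)
      ultimately show ?thesis by simp
    qed (rule off)
    then show ?thesis by (simp add: holomorphic_on_def field_differentiable_at_within)
  qed
  have "h z = 1"
    using entire_doubly_periodic_constant[OF \<tau> hhol h1 h2, of z 0] h0 by simp
  moreover have "N z = 0" if z0: "sigma \<tau> z = 0"
  proof -
    obtain m n :: int where "z = of_int m + of_int n * \<tau>" using z0 sigma_eq_0_iff[OF \<tau>] by blast
    then have "sigma \<tau>' (z / u) = 0" using lat sigma_eq_0_iff[OF \<tau>'] by blast
    then show ?thesis by (simp add: N_def)
  qed
  ultimately have "N z = sigma \<tau> z"
    by (cases "sigma \<tau> z = 0") (auto simp: h_def)
  then show ?thesis using u by (simp add: N_def epi_minus field_simps)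
qed

section \<open>Growth near the boundary\<close>

lemma two_sinh_Lipschitz:
  obtains C where "C \<ge> 1" "\<And>z. norm z \<le> 1 \<Longrightarrow> norm (two_sinh z) \<le> C * norm z"
proof -
  define D where "D = (\<lambda>z. of_real pi * \<i> * exp (of_real pi * \<i> * z) + of_real pi * \<i> * exp (- (of_real pi * \<i> * z)))"
  have "continuous_on (cball 0 1) D" unfolding D_def by (intro continuous_intros)
  then have "compact (D ` cball 0 1)" by (intro compact_continuous_image) auto
  then obtain C0 where C0: "\<And>z. norm z \<le> 1 \<Longrightarrow> norm (D z) \<le> C0"
    using compact_imp_bounded bounded_iff by (metis imageI mem_cball_0)
  have "norm (two_sinh z) \<le> max C0 1 * norm z" if "norm z \<le> 1" for z
  proof -
    have "norm (two_sinh z - two_sinh 0) \<le> C0 * norm (z - 0)"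
    proof (rule field_differentiable_bound[of "cball 0 1" two_sinh D])
      show "(two_sinh has_field_derivative D x) (at x within cball 0 1)" for x
        unfolding two_sinh_def[abs_def] D_def by (auto intro!: derivative_eq_intros simp: algebra_simps)
    qed (use C0 that in auto)
    also have "\<dots> \<le> max C0 1 * norm (z - 0)" by (intro mult_right_mono) auto
    finally show ?thesis by simp
  qed
  then show ?thesis using that[of "max C0 1"] by auto
qed

text \<open>
  With \<open>r = |q|\<close> the coefficients are dominated by \<open>r\<^sup>m / (1 - r)\<^sup>2\<close>, and \<open>1 / (1 - r)\<close> grows only like
  \<open>1 / Im \<tau>\<close> towards the real axis.
\<close>

lemma sum_norm_coef_le:
  assumes \<tau>: "Im \<tau> > 0"
  shows "(\<Sum>m<N. norm (product_coef \<tau> m)) \<le> (1 + 1 / Im \<tau>) ^ 3"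
proof -
  define r where "r = norm (nome \<tau>)"
  have r: "0 \<le> r" "r < 1" using norm_nome_less_1[OF \<tau>] by (auto simp: r_def)
  have r': "1 / (1 - r) \<le> 1 + 1 / Im \<tau>"
  proof -
    define x where "x = 2 * pi * Im \<tau>"
    have x: "x > 0" "Im \<tau> \<le> x" using \<tau> pi_gt3 by (auto simp: x_def)
    have "r = inverse (exp x)" by (simp add: r_def norm_nome x_def exp_minus)
    also have "\<dots> \<le> inverse (1 + x)" using x exp_ge_add_one_self[of x] by (intro le_imp_inverse_le) auto
    finally have "x / (1 + x) \<le> 1 - r" using x by (simp add: field_simps)
    then have "1 / (1 - r) \<le> 1 / (x / (1 + x))" using x r by (intro divide_left_mono) auto
    also have "\<dots> = 1 + 1 / x" using x by (simp add: field_simps)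
    also have "\<dots> \<le> 1 + 1 / Im \<tau>" using x \<tau> by (simp add: frac_le)
    finally show ?thesis .
  qed
  have "(\<Sum>m<N. norm (product_coef \<tau> m)) \<le> (\<Sum>m<N. r ^ m / (1 - r)\<^sup>2)"
  proof (rule sum_mono)
    fix m
    have "norm (product_coef \<tau> m) \<le> r ^ Suc m / (1 - r)\<^sup>2" using norm_coef_le[of \<tau> r m] r by (simp add: r_def)
    also have "\<dots> \<le> r ^ m / (1 - r)\<^sup>2" using r by (intro divide_right_mono) (auto simp: mult_left_le_one_le)
    finally show "norm (product_coef \<tau> m) \<le> r ^ m / (1 - r)\<^sup>2" .
  qed
  also have "\<dots> = (\<Sum>m<N. r ^ m) / (1 - r)\<^sup>2" by (simp add: sum_divide_distrib)
  also have "\<dots> \<le> (1 / (1 - r)) / (1 - r)\<^sup>2"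
  proof (intro divide_right_mono)
    have "(\<Sum>m<N. r ^ m) \<le> suminf (\<lambda>m. r ^ m)" using r by (intro sum_le_suminf summable_geometric) auto
    then show "(\<Sum>m<N. r ^ m) \<le> 1 / (1 - r)" using r by (simp add: suminf_geometric)
  qed auto
  also have "\<dots> = (1 / (1 - r)) ^ 3" by (simp add: power_divide power2_eq_square power3_eq_cube)
  also have "\<dots> \<le> (1 + 1 / Im \<tau>) ^ 3" using r r' by (intro power_mono) auto
  finally show ?thesis .
qed

lemma norm_even_factor_le:
  assumes \<tau>: "Im \<tau> > 0" and w: "norm w * (1 + 1 / Im \<tau>) ^ 3 \<le> 1"
  shows "norm (even_factor \<tau> w) \<le> exp 1"
proof (rule Lim_bounded[OF tendsto_norm[OF even_factor_limit[OF \<tau>]]])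
  show "\<forall>N\<ge>0. norm (\<Prod>m<N. 1 - product_coef \<tau> m * w) \<le> exp 1"
  proof (intro allI impI)
    fix N :: nat
    have "norm (\<Prod>m<N. 1 - product_coef \<tau> m * w) \<le> (\<Prod>m<N. 1 + norm (product_coef \<tau> m * w))"
      unfolding prod_norm[symmetric]
    proof (intro prod_mono conjI)
      show "norm (1 - product_coef \<tau> m * w) \<le> 1 + norm (product_coef \<tau> m * w)" for m
        using norm_triangle_ineq4[of 1 "product_coef \<tau> m * w"] by simp
    qed auto
    also have "\<dots> \<le> exp (\<Sum>m<N. norm (product_coef \<tau> m * w))" by (rule prod_le_exp_sum) auto
    also have "(\<Sum>m<N. norm (product_coef \<tau> m * w)) = norm w * (\<Sum>m<N. norm (product_coef \<tau> m))"
      by (simp add: norm_mult sum_distrib_left mult.commute)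
    also have "\<dots> \<le> norm w * (1 + 1 / Im \<tau>) ^ 3" by (intro mult_left_mono sum_norm_coef_le \<tau>) auto
    also have "\<dots> \<le> 1" by (rule w)
    finally show "norm (\<Prod>m<N. 1 - product_coef \<tau> m * w) \<le> exp 1" by simp
  qed
qed

text \<open>
  The product stays bounded as long as \<open>|s|\<^sup>2\<close> times the sum of its coefficients is at most 1. As \<open>s\<close> is
  of the size of \<open>z\<close>, this allows a disc in \<open>z\<close> whose radius shrinks only polynomially in \<open>Im \<tau>\<close>.
  Cauchy's inequality on this disc then makes all Taylor coefficients in \<open>z\<close> grow polynomially.
\<close>

lemma sigma_bounded_near_0:
  obtains C where "C \<ge> 1"
    "\<And>\<tau> z. Im \<tau> > 0 \<Longrightarrow> norm z \<le> 1 / (C * (1 + 1 / Im \<tau>)\<^sup>2) \<Longrightarrow> norm (sigma \<tau> z) \<le> exp 1"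
proof -
  obtain C where C: "C \<ge> 1" "\<And>z. norm z \<le> 1 \<Longrightarrow> norm (two_sinh z) \<le> C * norm z"
    using two_sinh_Lipschitz by blast
  have "norm (sigma \<tau> z) \<le> exp 1" if \<tau>: "Im \<tau> > 0" and z: "norm z \<le> 1 / (C * (1 + 1 / Im \<tau>)\<^sup>2)" for \<tau> z
  proof -
    define Y where "Y = 1 + 1 / Im \<tau>"
    have Y: "Y \<ge> 1" using \<tau> by (simp add: Y_def)
    have Y2: "Y\<^sup>2 \<ge> 1" using Y by (simp add: one_le_power)
    have CY: "C * Y\<^sup>2 \<ge> 1" using mult_mono[of 1 C 1 "Y\<^sup>2"] C Y2 by simp
    have "1 / (C * Y\<^sup>2) \<le> 1" using CY by simp
    then have "norm z \<le> 1" using z by (simp add: Y_def)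
    then have "norm (two_sinh z) \<le> C * norm z" by (rule C)
    also have "\<dots> \<le> C * (1 / (C * Y\<^sup>2))" using z C by (intro mult_left_mono) (auto simp: Y_def)
    also have "\<dots> = 1 / Y\<^sup>2" using C by simp
    finally have s: "norm (two_sinh z) \<le> 1 / Y\<^sup>2" .
    have "norm ((two_sinh z)\<^sup>2) * Y ^ 3 \<le> (1 / Y\<^sup>2)\<^sup>2 * Y ^ 3"
      unfolding norm_power using s Y by (intro mult_right_mono power_mono) auto
    also have "\<dots> = 1 / Y" using Y by (simp add: field_simps power2_eq_square power3_eq_cube)
    also have "\<dots> \<le> 1" using Y by simp
    finally have "norm (even_factor \<tau> ((two_sinh z)\<^sup>2)) \<le> exp 1"
      using norm_even_factor_le[OF \<tau>] by (simp add: Y_def)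
    moreover have "norm (two_sinh z) \<le> 1" using s Y2 by (smt (verit) divide_le_eq_1)
    ultimately show ?thesis
      using mult_mono[of "norm (two_sinh z)" 1 "norm (even_factor \<tau> ((two_sinh z)\<^sup>2))" "exp 1"]
      by (simp add: sigma_eq[OF \<tau>] norm_mult)
  qed
  with C(1) that show ?thesis by blast
qed

section \<open>Holomorphic functions on the atlas\<close>

lemma holomorphic_at_const [simp]: "holomorphic_at (\<lambda>_. c) p"
  unfolding holomorphic_at_def by (intro exI[of _ "\<lambda>_. 0"]) auto

lemma holomorphic_at_fst [simp]: "holomorphic_at fst p"
  unfolding holomorphic_at_def
  by (intro exI[of _ fst] conjI) (auto intro: bounded_linear_imp_has_derivative bounded_linear_fst)

lemma holomorphic_at_coord [simp]: "holomorphic_at (\<lambda>p. snd p $ j) p"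
proof -
  have "((\<lambda>p. snd p $ j) has_derivative (\<lambda>v. snd v $ j)) (at p)"
    by (rule bounded_linear_imp_has_derivative
        [OF bounded_linear_compose[OF bounded_linear_vec_nth bounded_linear_snd]])
  then show ?thesis
    unfolding holomorphic_at_def by (intro exI[of _ "\<lambda>v. snd v $ j"]) simp
qed

lemma holomorphic_at_compose2:
  assumes F: "((\<lambda>(x, y). F x y) has_derivative (\<lambda>(s, t). \<alpha> * s + \<beta> * t)) (at (f p, g p))"
    and fg: "holomorphic_at f p" "holomorphic_at g p"
  shows "holomorphic_at (\<lambda>p. F (f p) (g p)) p"
proof -
  obtain D where D: "(f has_derivative D) (at p)" "\<And>c v. D (c * fst v, c *s snd v) = c * D v"
    using fg(1) unfolding holomorphic_at_def by blast
  obtain E where E: "(g has_derivative E) (at p)" "\<And>c v. E (c * fst v, c *s snd v) = c * E v"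
    using fg(2) unfolding holomorphic_at_def by blast
  have "((\<lambda>p. (f p, g p)) has_derivative (\<lambda>v. (D v, E v))) (at p)"
    by (rule has_derivative_Pair[OF D(1) E(1)])
  from diff_chain_at[OF this F] have "((\<lambda>p. F (f p) (g p)) has_derivative (\<lambda>v. \<alpha> * D v + \<beta> * E v)) (at p)"
    by (simp add: o_def)
  moreover have "\<alpha> * D (c * fst v, c *s snd v) + \<beta> * E (c * fst v, c *s snd v) = c * (\<alpha> * D v + \<beta> * E v)" for c v
    by (simp only: D(2) E(2) algebra_simps)
  ultimately show ?thesis unfolding holomorphic_at_def by blast
qed

lemma holomorphic_at_compose:
  assumes "(F has_field_derivative d) (at (f p))" "holomorphic_at f p"
  shows "holomorphic_at (\<lambda>p. F (f p)) p"
proof (rule holomorphic_at_compose2[where F = "\<lambda>x _. F x" and g = f and \<alpha> = d and \<beta> = 0])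
  have "((\<lambda>v. F (fst v)) has_derivative (\<lambda>v. d * fst v)) (at (f p, f p))"
    using has_derivative_compose[OF bounded_linear_imp_has_derivative[OF bounded_linear_fst], of F "(*) d" "(f p, f p)"] assms(1)
    by (simp add: has_field_derivative_def)
  then show "((\<lambda>(x, y). F x) has_derivative (\<lambda>(s, t). d * s + 0 * t)) (at (f p, f p))"
    by (simp add: case_prod_unfold)
qed (use assms in auto)

lemma holomorphic_at_add:
  "holomorphic_at f p \<Longrightarrow> holomorphic_at g p \<Longrightarrow> holomorphic_at (\<lambda>p. f p + g p) p"
  by (rule holomorphic_at_compose2[where F = "(+)" and \<alpha> = 1 and \<beta> = 1])
    (auto simp: case_prod_unfold intro!: derivative_eq_intros)

lemma holomorphic_at_mult:
  "holomorphic_at f p \<Longrightarrow> holomorphic_at g p \<Longrightarrow> holomorphic_at (\<lambda>p. f p * g p) p"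
  by (rule holomorphic_at_compose2[where F = "(*)" and \<alpha> = "g p" and \<beta> = "f p"])
    (auto simp: case_prod_unfold fun_eq_iff intro!: derivative_eq_intros)

lemma holomorphic_at_inverse:
  "holomorphic_at f p \<Longrightarrow> f p \<noteq> 0 \<Longrightarrow> holomorphic_at (\<lambda>p. inverse (f p)) p"
  by (rule holomorphic_at_compose[OF DERIV_inverse])

lemma holomorphic_at_divide:
  "holomorphic_at f p \<Longrightarrow> holomorphic_at g p \<Longrightarrow> g p \<noteq> 0 \<Longrightarrow> holomorphic_at (\<lambda>p. f p / g p) p"
  unfolding divide_inverse by (intro holomorphic_at_mult holomorphic_at_inverse)

lemma holomorphic_at_uminus: "holomorphic_at f p \<Longrightarrow> holomorphic_at (\<lambda>p. - f p) p"
  using holomorphic_at_mult[of "\<lambda>_. -1" p f] by simp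

lemma holomorphic_at_diff:
  "holomorphic_at f p \<Longrightarrow> holomorphic_at g p \<Longrightarrow> holomorphic_at (\<lambda>p. f p - g p) p"
  using holomorphic_at_add[OF _ holomorphic_at_uminus, of f p g] by simp

lemma holomorphic_at_power: "holomorphic_at f p \<Longrightarrow> holomorphic_at (\<lambda>p. f p ^ k) p"
  by (induction k) (auto intro: holomorphic_at_mult)

lemma holomorphic_at_prod:
  "(\<And>j. j \<in> J \<Longrightarrow> holomorphic_at (f j) p) \<Longrightarrow> holomorphic_at (\<lambda>p. \<Prod>j\<in>J. f j p) p"
  by (induction J rule: infinite_finite_induct) (auto intro: holomorphic_at_mult)

lemma holomorphic_at_sum:
  "(\<And>j. j \<in> J \<Longrightarrow> holomorphic_at (f j) p) \<Longrightarrow> holomorphic_at (\<lambda>p. \<Sum>j\<in>J. f j p) p"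
  by (induction J rule: infinite_finite_induct) (auto intro: holomorphic_at_add)

lemma holomorphic_at_epi: "holomorphic_at f p \<Longrightarrow> holomorphic_at (\<lambda>p. epi (f p)) p"
  unfolding epi_def
  by (rule holomorphic_at_compose[where F = "\<lambda>x. exp (of_real pi * \<i> * x)"]) (auto intro!: derivative_eq_intros)

lemma holomorphic_at_isCont: "holomorphic_at f p \<Longrightarrow> isCont f p"
  unfolding holomorphic_at_def using has_derivative_continuous by blast

lemma holomorphic_at_transform:
  assumes "holomorphic_at f p" "open V" "p \<in> V" "\<And>p'. p' \<in> V \<Longrightarrow> f p' = g p'"
  shows "holomorphic_at g p"
  using assms unfolding holomorphic_at_def by (meson has_derivative_transform_within_open)

text \<open>
  Osgood's lemma is applied to \<open>even_factor\<close>; the sine factor and its square are elementary.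
\<close>

lemma holomorphic_at_sigma:
  assumes fg: "holomorphic_at f p" "holomorphic_at g p" and Im: "Im (f p) > 0"
  shows "holomorphic_at (\<lambda>p. sigma (f p) (g p)) p"
proof -
  have s: "holomorphic_at (\<lambda>p. two_sinh (g p)) p"
    unfolding two_sinh_epi by (intro holomorphic_at_diff holomorphic_at_epi holomorphic_at_uminus fg)
  obtain \<alpha> \<beta> where "((\<lambda>(\<tau>, w). even_factor \<tau> w) has_derivative (\<lambda>(s, t). \<alpha> * s + \<beta> * t))
      (at (f p, (two_sinh (g p))\<^sup>2))"
    using even_factor_has_derivative[OF Im] by blast
  then have e: "holomorphic_at (\<lambda>p. even_factor (f p) ((two_sinh (g p))\<^sup>2)) p"
    by (rule holomorphic_at_compose2[where F = even_factor and f = f, OF _ fg(1) holomorphic_at_power[OF s]])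
  have "isCont (\<lambda>p. Im (f p)) p"
    by (rule continuous_Im[OF holomorphic_at_isCont[OF fg(1)]])
  then have "\<forall>\<^sub>F p' in at p. Im (f p') > 0"
    using order_tendstoD(1)[of "\<lambda>p. Im (f p)" "Im (f p)" "at p" 0] Im by (simp add: isCont_def)
  then have "\<forall>\<^sub>F p' in nhds p. Im (f p') > 0"
    using Im by (simp add: eventually_nhds_conv_at)
  then obtain V where V: "open V" "p \<in> V" "\<And>p'. p' \<in> V \<Longrightarrow> Im (f p') > 0"
    unfolding eventually_nhds by blast
  show ?thesis
    by (rule holomorphic_at_transform[OF holomorphic_at_mult[OF s e] V(1,2)])
      (use V(3) sigma_eq in auto)
qed

lemmas holomorphic_at_intros = holomorphic_at_const holomorphic_at_fst holomorphic_at_coord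
  holomorphic_at_add holomorphic_at_mult holomorphic_at_divide holomorphic_at_uminus holomorphic_at_diff
  holomorphic_at_power holomorphic_at_prod holomorphic_at_epi holomorphic_at_sigma


section \<open>The Jacobi group action\<close>

lemma atlas_iff: "p \<in> atlas \<longleftrightarrow> Im (fst p) > 0"
  by (cases p) (simp add: atlas_def upper_half_plane_def)

lemma SL2Z_det: "\<gamma> \<in> SL2Z \<Longrightarrow> \<gamma> $ 1 $ 1 * \<gamma> $ 2 $ 2 - \<gamma> $ 1 $ 2 * \<gamma> $ 2 $ 1 = 1"
  by (simp add: SL2Z_def det_2)

lemma SL2Z_mult: "\<gamma> \<in> SL2Z \<Longrightarrow> \<gamma>' \<in> SL2Z \<Longrightarrow> \<gamma> ** \<gamma>' \<in> SL2Z"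
  by (simp add: SL2Z_def det_mul)

lemma mat_1_SL2Z [simp]: "mat 1 \<in> SL2Z"
  by (simp add: SL2Z_def)

lemma denom_mat_1 [simp]: "denom (mat 1) \<tau> = 1"
  by (simp add: denom_def mat_def)

lemma moebius_mat_1 [simp]: "moebius (mat 1) \<tau> = \<tau>"
  by (simp add: moebius_def) (simp add: mat_def)

lemma denom_nonzero:
  assumes "\<gamma> \<in> SL2Z" "Im \<tau> > 0"
  shows "denom \<gamma> \<tau> \<noteq> 0"
proof
  assume 0: "denom \<gamma> \<tau> = 0"
  have "real_of_int (\<gamma> $ 2 $ 1) * Im \<tau> = 0" using arg_cong[OF 0, of Im] by (simp add: denom_def)
  then have c: "\<gamma> $ 2 $ 1 = 0" using assms by simp
  then have "\<gamma> $ 2 $ 2 = 0" using 0 by (simp add: denom_def)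
  then show False using SL2Z_det[OF assms(1)] c by simp
qed

lemma Im_moebius_pos:
  assumes "\<gamma> \<in> SL2Z" "Im \<tau> > 0"
  shows "Im (moebius \<gamma> \<tau>) > 0"
proof -
  define a b c d where "a = real_of_int (\<gamma> $ 1 $ 1)" and "b = real_of_int (\<gamma> $ 1 $ 2)"
    and "c = real_of_int (\<gamma> $ 2 $ 1)" and "d = real_of_int (\<gamma> $ 2 $ 2)"
  have det: "a * d - b * c = 1"
    using arg_cong[OF SL2Z_det[OF assms(1)], of real_of_int] by (simp add: a_def b_def c_def d_def)
  have "(Re (denom \<gamma> \<tau>))\<^sup>2 + (Im (denom \<gamma> \<tau>))\<^sup>2 > 0"
    using denom_nonzero[OF assms] complex_neq_0 by blast
  moreover have "a * Im \<tau> * (c * Re \<tau> + d) - (a * Re \<tau> + b) * (c * Im \<tau>) = Im \<tau>"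
    using det by algebra
  ultimately show ?thesis
    using assms(2) by (simp add: moebius_def Im_divide denom_def a_def b_def c_def d_def)
qed

lemma jacobi_act_atlas:
  assumes "p \<in> atlas" "\<gamma> \<in> SL2Z"
  shows "jacobi_act (m, n, \<gamma>) p \<in> atlas"
  using assms by (cases p) (simp add: atlas_iff Im_moebius_pos)

lemma denom_mult:
  assumes "\<gamma>' \<in> SL2Z" "Im \<tau> > 0"
  shows "denom (\<gamma> ** \<gamma>') \<tau> = denom \<gamma> (moebius \<gamma>' \<tau>) * denom \<gamma>' \<tau>"
  using denom_nonzero[OF assms]
  by (simp add: denom_def[of "\<gamma> ** \<gamma>'"] denom_def[of \<gamma>] moebius_def matrix_matrix_mult_def sum_2 field_simps)
    (simp add: denom_def algebra_simps)

lemma moebius_mult: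
  assumes "\<gamma> \<in> SL2Z" "\<gamma>' \<in> SL2Z" "Im \<tau> > 0"
  shows "moebius (\<gamma> ** \<gamma>') \<tau> = moebius \<gamma> (moebius \<gamma>' \<tau>)"
proof -
  define u where "u = denom \<gamma>' \<tau>"
  have u: "u \<noteq> 0" using denom_nonzero assms by (simp add: u_def)
  define v where "v = denom \<gamma> (moebius \<gamma>' \<tau>)"
  have v: "v \<noteq> 0" unfolding v_def using assms by (intro denom_nonzero Im_moebius_pos)
  have "of_int ((\<gamma> ** \<gamma>') $ 1 $ 1) * \<tau> + of_int ((\<gamma> ** \<gamma>') $ 1 $ 2) =
      (of_int (\<gamma> $ 1 $ 1) * moebius \<gamma>' \<tau> + of_int (\<gamma> $ 1 $ 2)) * u"
    using u unfolding moebius_def u_def[symmetric]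
    by (simp add: matrix_matrix_mult_def sum_2 field_simps) (simp add: u_def denom_def algebra_simps)
  then show ?thesis
    using u v unfolding moebius_def[of "\<gamma> ** \<gamma>'"] moebius_def[of \<gamma>] denom_mult[OF assms(2,3)]
    by (simp add: u_def[symmetric] v_def[symmetric])
qed

lemma jacobi_act_mult:
  assumes p: "p \<in> atlas" and \<gamma>: "\<gamma> \<in> SL2Z" "\<gamma>' \<in> SL2Z"
  shows "jacobi_act (jacobi_mult (m, n, \<gamma>) (m', n', \<gamma>')) p = jacobi_act (m, n, \<gamma>) (jacobi_act (m', n', \<gamma>') p)"
proof -
  obtain \<tau> z where pz: "p = (\<tau>, z)" by (cases p)
  have \<tau>: "Im \<tau> > 0" using p by (simp add: pz atlas_iff)
  define u where "u = denom \<gamma>' \<tau>"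
  have u: "u \<noteq> 0" using denom_nonzero \<gamma> \<tau> by (simp add: u_def)
  define v where "v = denom \<gamma> (moebius \<gamma>' \<tau>)"
  have v: "v \<noteq> 0" unfolding v_def using \<gamma> \<tau> by (intro denom_nonzero Im_moebius_pos)
  have mu: "moebius \<gamma>' \<tau> = (of_int (\<gamma>' $ 1 $ 1) * \<tau> + of_int (\<gamma>' $ 1 $ 2)) / u"
    by (simp add: moebius_def u_def)
  have "(z $ i + of_int (m $ i * \<gamma>' $ 2 $ 2 + n $ i * \<gamma>' $ 1 $ 2 + m' $ i) +
      of_int (m $ i * \<gamma>' $ 2 $ 1 + n $ i * \<gamma>' $ 1 $ 1 + n' $ i) * \<tau>) / (v * u) =
    ((z $ i + of_int (m' $ i) + of_int (n' $ i) * \<tau>) / u + of_int (m $ i) + of_int (n $ i) * moebius \<gamma>' \<tau>) / v" for i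
  proof -
    have "z $ i + of_int (m $ i * \<gamma>' $ 2 $ 2 + n $ i * \<gamma>' $ 1 $ 2 + m' $ i) +
      of_int (m $ i * \<gamma>' $ 2 $ 1 + n $ i * \<gamma>' $ 1 $ 1 + n' $ i) * \<tau> =
      z $ i + of_int (m' $ i) + of_int (n' $ i) * \<tau> + of_int (m $ i) * u +
        of_int (n $ i) * (of_int (\<gamma>' $ 1 $ 1) * \<tau> + of_int (\<gamma>' $ 1 $ 2))"
      by (simp add: u_def denom_def algebra_simps)
    then show ?thesis using u v by (simp add: mu field_simps)
  qed
  then show ?thesis
    using \<gamma> \<tau> by (simp add: pz moebius_mult denom_mult vec_eq_iff u_def[symmetric] v_def[symmetric])
qed


section \<open>The twisted products and their automorphy factor\<close>

text \<open>
  The exponent \<open>k\<close> treats both groups at once: \<open>k = 0\<close> gives \<open>sigma\<close> and \<open>k = 1\<close> gives \<open>upsilon\<close>.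
\<close>

definition twisted_sigma :: "nat \<Rightarrow> complex \<Rightarrow> complex \<Rightarrow> complex"
  where "twisted_sigma k \<tau> z = (- epi z) ^ k * sigma \<tau> z"

definition sigma_prod :: "nat \<Rightarrow> ('n::finite) pt \<Rightarrow> complex"
  where "sigma_prod k p = (\<Prod>j\<in>UNIV. twisted_sigma k (fst p) (snd p $ j))"

lemma sigma_SO_eq: "sigma_SO = sigma_prod 0"
  by (simp add: fun_eq_iff sigma_SO_def sigma_prod_def twisted_sigma_def)

lemma sigma_U_eq: "sigma_U = sigma_prod 1"
  by (simp add: fun_eq_iff sigma_U_def sigma_prod_def twisted_sigma_def upsilon_def epi_def)

text \<open>
  The factor of automorphy in one coordinate: the change of the twist \<open>(-y\<^bsup>1/2\<^esup>)\<^sup>k\<close>, the modular factor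
  at the translated point, and the factor of the translation. Written out like this it is manifestly
  holomorphic and without zeros, also at the zeros of \<open>sigma\<close>.
\<close>

definition coord_factor :: "nat \<Rightarrow> int \<Rightarrow> int \<Rightarrow> int ^ 2 ^ 2 \<Rightarrow> complex \<Rightarrow> complex \<Rightarrow> complex"
  where "coord_factor k m n \<gamma> \<tau> z =
    (- epi ((z + of_int m + of_int n * \<tau>) / denom \<gamma> \<tau>)) ^ k / (- epi z) ^ k *
    (epi (of_int (\<gamma> $ 2 $ 1) * (z + of_int m + of_int n * \<tau>)\<^sup>2 / denom \<gamma> \<tau>) / denom \<gamma> \<tau>) *
    epi (of_int m + of_int n - of_int n ^ 2 * \<tau> - 2 * of_int n * z)"

fun jacobi_factor :: "nat \<Rightarrow> ('n::finite) jac \<Rightarrow> 'n pt \<Rightarrow> complex"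
  where "jacobi_factor k (m, n, \<gamma>) p = (\<Prod>j\<in>UNIV. coord_factor k (m $ j) (n $ j) \<gamma> (fst p) (snd p $ j))"

lemma twisted_sigma_transform:
  assumes "Im \<tau> > 0" "\<gamma> \<in> SL2Z"
  shows "twisted_sigma k (moebius \<gamma> \<tau>) ((z + of_int m + of_int n * \<tau>) / denom \<gamma> \<tau>) =
    coord_factor k m n \<gamma> \<tau> z * twisted_sigma k \<tau> z"
proof -
  have "sigma (moebius \<gamma> \<tau>) ((z + of_int m + of_int n * \<tau>) / denom \<gamma> \<tau>) =
      epi (of_int (\<gamma> $ 2 $ 1) * (z + of_int m + of_int n * \<tau>)\<^sup>2 / denom \<gamma> \<tau>) / denom \<gamma> \<tau> *
      sigma \<tau> (z + of_int m + of_int n * \<tau>)"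
    using sigma_modular[OF assms(1) SL2Z_det[OF assms(2)]] Im_moebius_pos[OF assms(2,1)] denom_nonzero[OF assms(2,1)]
    by (simp add: moebius_def denom_def)
  then show ?thesis
    unfolding twisted_sigma_def coord_factor_def
    using sigma_quasi_periodic[OF assms(1), of z m n] by simp
qed

lemma sigma_prod_transform:
  assumes "p \<in> atlas" "\<gamma> \<in> SL2Z"
  shows "sigma_prod k (jacobi_act (m, n, \<gamma>) p) = jacobi_factor k (m, n, \<gamma>) p * sigma_prod k p"
proof (cases p)
  case (Pair \<tau> z)
  then show ?thesis using assms twisted_sigma_transform[of \<tau> \<gamma>]
    by (simp add: atlas_iff sigma_prod_def prod.distrib)
qed

lemma coord_factor_nonzero: "denom \<gamma> \<tau> \<noteq> 0 \<Longrightarrow> coord_factor k m n \<gamma> \<tau> z \<noteq> 0"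
  by (simp add: coord_factor_def)

lemma holomorphic_at_denom: "holomorphic_at f p \<Longrightarrow> holomorphic_at (\<lambda>p. denom \<gamma> (f p)) p"
  unfolding denom_def by (intro holomorphic_at_intros)

lemma holomorphic_at_moebius:
  "holomorphic_at f p \<Longrightarrow> denom \<gamma> (f p) \<noteq> 0 \<Longrightarrow> holomorphic_at (\<lambda>p. moebius \<gamma> (f p)) p"
  unfolding moebius_def by (intro holomorphic_at_intros holomorphic_at_denom)

lemma holomorphic_at_coord_factor:
  "holomorphic_at f p \<Longrightarrow> holomorphic_at g p \<Longrightarrow> denom \<gamma> (f p) \<noteq> 0 \<Longrightarrow>
    holomorphic_at (\<lambda>p. coord_factor k m n \<gamma> (f p) (g p)) p"
  unfolding coord_factor_def by (intro holomorphic_at_intros holomorphic_at_denom) auto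

lemma holomorphic_at_sigma_prod:
  "p \<in> atlas \<Longrightarrow> holomorphic_at (sigma_prod k) p"
  unfolding sigma_prod_def[abs_def] twisted_sigma_def atlas_iff by (intro holomorphic_at_intros)

lemma holomorphic_at_jacobi_factor:
  assumes "p \<in> atlas" "\<gamma> \<in> SL2Z"
  shows "holomorphic_at (jacobi_factor k (m, n, \<gamma>)) p"
  unfolding jacobi_factor.simps[abs_def]
  using assms by (intro holomorphic_at_prod holomorphic_at_coord_factor holomorphic_at_intros denom_nonzero) (simp_all add: atlas_iff)

lemma jacobi_factor_nonzero:
  assumes "p \<in> atlas" "\<gamma> \<in> SL2Z"
  shows "jacobi_factor k (m, n, \<gamma>) p \<noteq> 0"
  using assms coord_factor_nonzero denom_nonzero by (auto simp: atlas_iff)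

text \<open>
  The zeros of \<open>sigma_prod\<close> have empty interior: on the diagonal line through any point, each factor
  has only isolated zeros. So an identity of continuous functions may be divided by \<open>sigma_prod\<close>.
\<close>

lemma eq_on_atlas:
  fixes F G :: "('n::finite) pt \<Rightarrow> complex"
  assumes p: "p \<in> atlas" and FG: "isCont F p" "isCont G p"
    and eq: "\<And>p. p \<in> atlas \<Longrightarrow> sigma_prod k p \<noteq> 0 \<Longrightarrow> F p = G p"
  shows "F p = G p"
proof -
  obtain \<tau> z where pz: "p = (\<tau>, z)" by (cases p)
  have \<tau>: "Im \<tau> > 0" using p by (simp add: pz atlas_iff)
  define path where "path = (\<lambda>\<epsilon>::complex. (\<tau>, \<chi> j. z $ j + \<epsilon>))"
  have lim: "(path \<longlongrightarrow> p) (at 0)"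
  proof -
    have "((\<lambda>\<epsilon>. (\<tau>, \<chi> j. z $ j + \<epsilon>)) \<longlongrightarrow> (\<tau>, \<chi> j. z $ j + 0)) (at (0::complex))"
      by (intro tendsto_intros)
    then show ?thesis by (simp add: path_def pz)
  qed
  have "\<forall>\<^sub>F \<epsilon> in at 0. \<forall>j\<in>UNIV. sigma \<tau> (z $ j + \<epsilon>) \<noteq> 0"
  proof (rule eventually_ball_finite, simp, rule ballI)
    fix j
    show "\<forall>\<^sub>F \<epsilon> in at 0. sigma \<tau> (z $ j + \<epsilon>) \<noteq> 0"
      using sigma_eventually_nonzero[OF \<tau>, of "z $ j"] by (subst (asm) eventually_at_to_0) (simp add: add.commute)
  qed
  then have ev: "\<forall>\<^sub>F \<epsilon> in at 0. F (path \<epsilon>) = G (path \<epsilon>)"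
  proof eventually_elim
    case (elim \<epsilon>)
    then show ?case
      by (intro eq) (auto simp: path_def atlas_iff \<tau> sigma_prod_def twisted_sigma_def)
  qed
  have "((\<lambda>\<epsilon>. F (path \<epsilon>)) \<longlongrightarrow> F p) (at 0)" "((\<lambda>\<epsilon>. G (path \<epsilon>)) \<longlongrightarrow> G p) (at 0)"
    using FG lim by (auto intro: isCont_tendsto_compose)
  from Lim_transform_eventually[OF this(1) ev] this(2) show ?thesis
    by (rule tendsto_unique[OF at_neq_bot])
qed

text \<open>
  Away from the zeros of \<open>sigma_prod\<close> the factor is the quotient of two of its values, and the cocycle
  identity says that the Jacobi group acts.
\<close>

lemma jacobi_factor_cocycle:
  assumes p: "p \<in> atlas" and \<gamma>: "\<gamma> \<in> SL2Z" "\<gamma>' \<in> SL2Z"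
  shows "jacobi_factor k (jacobi_mult (m, n, \<gamma>) (m', n', \<gamma>')) p =
    jacobi_factor k (m, n, \<gamma>) (jacobi_act (m', n', \<gamma>') p) * jacobi_factor k (m', n', \<gamma>') p"
proof (rule eq_on_atlas[OF p, of _ _ k])
  have act: "jacobi_act (m', n', \<gamma>') p = (moebius \<gamma>' (fst p), \<chi> i. (snd p $ i + of_int (m' $ i) + of_int (n' $ i) * fst p) / denom \<gamma>' (fst p))"
    for p :: "'a pt" by (cases p) simp
  have d: "denom \<gamma>' (fst p) \<noteq> 0" "denom \<gamma> (moebius \<gamma>' (fst p)) \<noteq> 0"
    using p \<gamma> by (auto simp: atlas_iff denom_nonzero Im_moebius_pos)
  show "isCont (jacobi_factor k (jacobi_mult (m, n, \<gamma>) (m', n', \<gamma>'))) p"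
    unfolding jacobi_mult.simps using p \<gamma>
    by (intro holomorphic_at_isCont holomorphic_at_jacobi_factor SL2Z_mult)
  have "holomorphic_at (\<lambda>p. jacobi_factor k (m, n, \<gamma>) (jacobi_act (m', n', \<gamma>') p)) p"
    unfolding act jacobi_factor.simps fst_conv snd_conv vec_lambda_beta using d
    by (intro holomorphic_at_prod holomorphic_at_coord_factor holomorphic_at_intros
        holomorphic_at_moebius holomorphic_at_denom)
  then show "isCont (\<lambda>p. jacobi_factor k (m, n, \<gamma>) (jacobi_act (m', n', \<gamma>') p) * jacobi_factor k (m', n', \<gamma>') p) p"
    using p \<gamma> by (intro holomorphic_at_isCont holomorphic_at_mult holomorphic_at_jacobi_factor)
  fix p :: "'a pt" assume q: "p \<in> atlas" "sigma_prod k p \<noteq> 0"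
  have "jacobi_factor k (jacobi_mult (m, n, \<gamma>) (m', n', \<gamma>')) p * sigma_prod k p =
      sigma_prod k (jacobi_act (jacobi_mult (m, n, \<gamma>) (m', n', \<gamma>')) p)"
    unfolding jacobi_mult.simps using q \<gamma> by (simp only: sigma_prod_transform SL2Z_mult)
  also have "\<dots> = jacobi_factor k (m, n, \<gamma>) (jacobi_act (m', n', \<gamma>') p) * (jacobi_factor k (m', n', \<gamma>') p * sigma_prod k p)"
    using q \<gamma> by (simp only: jacobi_act_mult sigma_prod_transform jacobi_act_atlas)
  finally show "jacobi_factor k (jacobi_mult (m, n, \<gamma>) (m', n', \<gamma>')) p =
      jacobi_factor k (m, n, \<gamma>) (jacobi_act (m', n', \<gamma>') p) * jacobi_factor k (m', n', \<gamma>') p"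
    using q(2) by simp
qed

text \<open>
  The Weyl groups under which \<open>sigma_prod k\<close> is invariant. As \<open>sigma\<close> is odd, an even number of signs is
  harmless for \<open>k = 0\<close>, but the twist breaks the symmetry under \<open>z \<mapsto> -z\<close>. The zero cocharacter is
  required so that modular matrices belong to the Jacobi group.
\<close>

definition compatible :: "nat \<Rightarrow> ('n::finite) lie_data \<Rightarrow> bool"
  where "compatible k G \<longleftrightarrow> 0 \<in> cochar G \<and> (\<forall>w\<in>weyl G. bij (snd w) \<and>
    ((\<forall>i. fst w i = 1) \<or>
     k = 0 \<and> (\<forall>i. fst w i = 1 \<or> fst w i = -1) \<and> (\<Prod>i\<in>UNIV. fst w i) = 1))"

text \<open>
  The quadratic terms do not see a common sign of \<open>z\<close>, \<open>m\<close> and \<open>n\<close>, and \<open>m + n\<close> changes by an even integer.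
\<close>

lemma coord_factor_sign:
  assumes "\<epsilon> = 1 \<or> k = 0 \<and> \<epsilon> = -1"
  shows "coord_factor k (\<epsilon> * m) (\<epsilon> * n) \<gamma> \<tau> (of_int \<epsilon> * z) = coord_factor k m n \<gamma> \<tau> z"
proof (cases "\<epsilon> = 1")
  case False
  then have \<epsilon>: "\<epsilon> = -1" "k = 0" using assms by auto
  have 1: "(- z + of_int (- m) + of_int (- n) * \<tau>)\<^sup>2 = (z + of_int m + of_int n * \<tau>)\<^sup>2"
    by (simp add: power2_eq_square algebra_simps)
  have 2: "epi (of_int (- m) + of_int (- n) - of_int (- n) ^ 2 * \<tau> - 2 * of_int (- n) * (- z)) =
      epi (of_int m + of_int n - of_int n ^ 2 * \<tau> - 2 * of_int n * z)"
    by (rule epi_cong_even[of _ _ "- 2 * (m + n)"]) (simp_all add: algebra_simps)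
  show ?thesis using 1 2 by (simp add: coord_factor_def \<epsilon>)
qed simp

lemma prod_permute:
  assumes "bij \<pi>"
  shows "(\<Prod>i\<in>UNIV. h (\<pi> i)) = (\<Prod>i\<in>(UNIV :: 'n::finite set). h i)"
  using prod.reindex_bij_betw[OF assms, of h] .

lemma jacobi_factor_weyl:
  assumes G: "compatible k G" and w: "w \<in> weyl G"
  shows "jacobi_factor k (weyl_act w m, weyl_act w n, \<gamma>) (\<tau>, weyl_act w z) = jacobi_factor k (m, n, \<gamma>) (\<tau>, z)"
proof -
  have s: "fst w i = 1 \<or> k = 0 \<and> fst w i = -1" "bij (snd w)" for i
    using G w unfolding compatible_def by blast+
  have "jacobi_factor k (weyl_act w m, weyl_act w n, \<gamma>) (\<tau>, weyl_act w z) =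
      (\<Prod>i\<in>UNIV. coord_factor k (m $ snd w i) (n $ snd w i) \<gamma> \<tau> (z $ snd w i))"
    by (simp add: weyl_act_def coord_factor_sign[OF s(1)])
  also have "\<dots> = jacobi_factor k (m, n, \<gamma>) (\<tau>, z)"
    using prod_permute[OF s(2), of "\<lambda>i. coord_factor k (m $ i) (n $ i) \<gamma> \<tau> (z $ i)"] by simp
  finally show ?thesis .
qed

lemma sigma_prod_weyl:
  assumes G: "compatible k G" and w: "w \<in> weyl G" and \<tau>: "Im \<tau> > 0"
  shows "sigma_prod k (\<tau>, weyl_act w z) = sigma_prod k (\<tau>, z)"
proof -
  have s: "fst w i = 1 \<or> k = 0 \<and> fst w i = -1" "bij (snd w)" "(\<Prod>i\<in>UNIV. fst w i) = 1" for i
    using G w unfolding compatible_def by auto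
  have "twisted_sigma k \<tau> (of_int (fst w i) * x) = of_int (fst w i) * twisted_sigma k \<tau> x" for i x
    using s(1)[of i] sigma_minus[OF \<tau>] by (auto simp: twisted_sigma_def)
  then have "sigma_prod k (\<tau>, weyl_act w z) =
      of_int (\<Prod>i\<in>UNIV. fst w i) * (\<Prod>i\<in>UNIV. twisted_sigma k \<tau> (z $ snd w i))"
    by (simp add: sigma_prod_def weyl_act_def prod.distrib)
  also have "\<dots> = sigma_prod k (\<tau>, z)"
    using prod_permute[OF s(2), of "\<lambda>i. twisted_sigma k \<tau> (z $ i)"] s(3) by (simp add: sigma_prod_def)
  finally show ?thesis .
qed

lemma jacobi_factor_automorphy:
  assumes "compatible k G"
  shows "automorphy_cocycle G (jacobi_factor k)"
  unfolding automorphy_cocycle_def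
proof (intro conjI ballI)
  fix g p assume g: "g \<in> jacobi_group G" and p: "p \<in> (atlas :: 'a pt set)"
  obtain m n \<gamma> where g': "g = (m, n, \<gamma>)" "\<gamma> \<in> SL2Z" using g by (cases g) (simp add: jacobi_group_def)
  show "holomorphic_at (jacobi_factor k g) p" "jacobi_factor k g p \<noteq> 0"
    unfolding g'(1) by (rule holomorphic_at_jacobi_factor[OF p g'(2)] jacobi_factor_nonzero[OF p g'(2)])+
next
  fix g h p assume g: "g \<in> jacobi_group G" and h: "h \<in> jacobi_group G" and p: "p \<in> (atlas :: 'a pt set)"
  obtain m n \<gamma> where g': "g = (m, n, \<gamma>)" "\<gamma> \<in> SL2Z" using g by (cases g) (simp add: jacobi_group_def)
  obtain m' n' \<gamma>' where h': "h = (m', n', \<gamma>')" "\<gamma>' \<in> SL2Z" using h by (cases h) (simp add: jacobi_group_def)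
  show "jacobi_factor k (jacobi_mult g h) p = jacobi_factor k g (jacobi_act h p) * jacobi_factor k h p"
    unfolding g'(1) h'(1) by (rule jacobi_factor_cocycle[OF p g'(2) h'(2)])
next
  fix w assume "w \<in> weyl G"
  then show "\<And>g. g \<in> jacobi_group G \<Longrightarrow> case g of (m, n, \<gamma>) \<Rightarrow> \<forall>(\<tau>, z)\<in>atlas.
      jacobi_factor k (weyl_act w m, weyl_act w n, \<gamma>) (\<tau>, weyl_act w z) = jacobi_factor k (m, n, \<gamma>) (\<tau>, z)"
    using jacobi_factor_weyl[OF assms] by (auto simp del: jacobi_factor.simps)
qed

lemma transforms_by_jacobi_factor: "transforms_by G (jacobi_factor k) (sigma_prod k)"
  unfolding transforms_by_def
proof (intro ballI)
  fix g p assume g: "g \<in> jacobi_group G" and p: "p \<in> (atlas :: 'a pt set)"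
  obtain m n \<gamma> where g': "g = (m, n, \<gamma>)" "\<gamma> \<in> SL2Z" using g by (cases g) (simp add: jacobi_group_def)
  show "sigma_prod k (jacobi_act g p) = jacobi_factor k g p * sigma_prod k p"
    unfolding g'(1) by (rule sigma_prod_transform[OF p g'(2)])
qed

lemma cocycle_of_sigma_prod:
  assumes "compatible k G"
  shows "automorphy_cocycle G (cocycle_of G (sigma_prod k))"
    "transforms_by G (cocycle_of G (sigma_prod k)) (sigma_prod k)"
  using someI[of "\<lambda>j. automorphy_cocycle G j \<and> transforms_by G j (sigma_prod k)",
      OF conjI[OF jacobi_factor_automorphy[OF assms] transforms_by_jacobi_factor]]
  by (simp_all add: cocycle_of_def)

text \<open>
  Two cocycles for \<open>sigma_prod\<close> agree where it does not vanish, hence everywhere; so the choice in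
  \<open>cocycle_of\<close> can be replaced by the explicit factor.
\<close>

lemma cocycle_of_eq:
  assumes G: "compatible k G" and g: "(m, n, \<gamma>) \<in> jacobi_group G" and p: "p \<in> atlas"
  shows "cocycle_of G (sigma_prod k) (m, n, \<gamma>) p = jacobi_factor k (m, n, \<gamma>) p"
proof (rule eq_on_atlas[OF p, of _ _ k])
  have \<gamma>: "\<gamma> \<in> SL2Z" using g by (simp add: jacobi_group_def)
  show "isCont (cocycle_of G (sigma_prod k) (m, n, \<gamma>)) p"
    using cocycle_of_sigma_prod(1)[OF G] g p unfolding automorphy_cocycle_def
    by (blast intro: holomorphic_at_isCont)
  show "isCont (jacobi_factor k (m, n, \<gamma>)) p"
    by (rule holomorphic_at_isCont[OF holomorphic_at_jacobi_factor[OF p \<gamma>]])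
  fix q :: "'a pt" assume q: "q \<in> atlas" "sigma_prod k q \<noteq> 0"
  have "cocycle_of G (sigma_prod k) (m, n, \<gamma>) q * sigma_prod k q = sigma_prod k (jacobi_act (m, n, \<gamma>) q)"
    using cocycle_of_sigma_prod(2)[OF G] g q(1) unfolding transforms_by_def by force
  also have "\<dots> = jacobi_factor k (m, n, \<gamma>) q * sigma_prod k q"
    by (rule sigma_prod_transform[OF q(1) \<gamma>])
  finally show "cocycle_of G (sigma_prod k) (m, n, \<gamma>) q = jacobi_factor k (m, n, \<gamma>) q"
    using q(2) by simp
qed

section \<open>Polynomial growth along geodesics\<close>

lemma twisted_sigma_holomorphic: "Im \<tau> > 0 \<Longrightarrow> twisted_sigma k \<tau> holomorphic_on A"
  unfolding twisted_sigma_def[abs_def] by (intro holomorphic_intros sigma_holomorphic)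

text \<open>
  A product of functions of single coordinates is differentiated coordinate by coordinate.
\<close>

lemma foldr_partial_z_prod:
  fixes g :: "'n::finite \<Rightarrow> complex \<Rightarrow> complex"
  assumes g: "\<And>j. g j holomorphic_on UNIV" and f: "\<And>z. f (\<tau>, z) = (\<Prod>j\<in>UNIV. g j (z $ j))"
  shows "foldr partial_z is f (\<tau>, z) = (\<Prod>j\<in>UNIV. (deriv ^^ count_list is j) (g j) (z $ j))"
proof (induction "is" arbitrary: z)
  case (Cons i "is")
  define h where "h = (\<lambda>j. (deriv ^^ count_list is j) (g j))"
  have hol: "h j holomorphic_on UNIV" for j
    unfolding h_def by (intro holomorphic_higher_deriv g open_UNIV)
  have "foldr partial_z (i # is) f (\<tau>, z) = deriv (\<lambda>w. foldr partial_z is f (\<tau>, z + axis i w)) 0"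
    by (simp add: partial_z_def)
  also have "(\<lambda>w. foldr partial_z is f (\<tau>, z + axis i w)) = (\<lambda>w. \<Prod>j\<in>UNIV. h j ((z + axis i w) $ j))"
    unfolding Cons.IH h_def ..
  also have "\<dots> = (\<lambda>w. h i (z $ i + w) * (\<Prod>j\<in>UNIV - {i}. h j (z $ j)))"
  proof
    fix w
    have "(\<Prod>j\<in>UNIV. h j ((z + axis i w) $ j)) =
        h i ((z + axis i w) $ i) * (\<Prod>j\<in>UNIV - {i}. h j ((z + axis i w) $ j))"
      by (rule prod.remove) auto
    also have "(\<Prod>j\<in>UNIV - {i}. h j ((z + axis i w) $ j)) = (\<Prod>j\<in>UNIV - {i}. h j (z $ j))"
      by (intro prod.cong) (auto simp: axis_def)
    finally show "(\<Prod>j\<in>UNIV. h j ((z + axis i w) $ j)) = h i (z $ i + w) * (\<Prod>j\<in>UNIV - {i}. h j (z $ j))"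
      by (simp add: axis_def)
  qed
  also have "deriv \<dots> 0 = deriv (h i) (z $ i) * (\<Prod>j\<in>UNIV - {i}. h j (z $ j))"
  proof (rule DERIV_imp_deriv)
    have "(h i has_field_derivative deriv (h i) (z $ i)) (at (z $ i + 0))"
      using holomorphic_derivI[OF hol open_UNIV, of "z $ i"] by simp
    then have "((\<lambda>w. h i (z $ i + w)) has_field_derivative deriv (h i) (z $ i)) (at 0)"
      using DERIV_shift[of "h i" "deriv (h i) (z $ i)" 0 "z $ i"] by (simp add: add.commute)
    then show "((\<lambda>w. h i (z $ i + w) * (\<Prod>j\<in>UNIV - {i}. h j (z $ j))) has_field_derivative
        deriv (h i) (z $ i) * (\<Prod>j\<in>UNIV - {i}. h j (z $ j))) (at 0)"
      by (rule DERIV_cmult_right)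
  qed
  also have "\<dots> = (\<Prod>j\<in>UNIV. (deriv ^^ count_list (i # is) j) (g j) (z $ j))"
    by (subst (2) prod.remove[of _ i]) (auto simp: h_def intro!: prod.cong)
  finally show ?case .
qed (simp add: f)

lemma poly_growth_const: "poly_growth V (\<lambda>_. c)"
proof -
  have z: "partial_z i (\<lambda>_. x) = (\<lambda>_. 0)" for i and x :: complex
    by (simp add: partial_z_def fun_eq_iff)
  have "foldr partial_z is (\<lambda>_. c) = (\<lambda>_. if is = [] then c else 0)" for "is" :: "'a list"
    by (induction "is") (auto simp: z)
  then have "norm (foldr partial_z is (\<lambda>_. c) p) \<le> norm c" for "is" and p :: "'a pt" by simp
  then show ?thesis
    unfolding poly_growth_def by (intro allI impI exI[of _ 0] bigoI[where c = "norm c"]) simp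
qed

lemma Im_geodesic:
  assumes "det A = 1"
  shows "Im (geodesic A t) = t / ((A $ 2 $ 1)\<^sup>2 * t\<^sup>2 + (A $ 2 $ 2)\<^sup>2)"
proof -
  have "A $ 1 $ 1 * t * A $ 2 $ 2 - A $ 1 $ 2 * (A $ 2 $ 1 * t) = t"
    using assms unfolding det_2 by algebra
  then show ?thesis by (simp add: geodesic_def Im_divide power_mult_distrib add.commute)
qed

lemma geodesic_denominator_pos:
  fixes A :: "real ^ 2 ^ 2"
  assumes "det A = 1" "t > 0"
  shows "(A $ 2 $ 1)\<^sup>2 * t\<^sup>2 + (A $ 2 $ 2)\<^sup>2 > 0"
proof (cases "A $ 2 $ 1 = 0")
  case True
  then show ?thesis using assms by (auto simp: det_2)
next
  case False
  then show ?thesis using assms by (simp add: add_pos_nonneg)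
qed

text \<open>
  Towards infinity \<open>1 / Im \<tau>\<close> decreases along a geodesic, and towards a real point, rational or not, it
  grows linearly in the parameter.
\<close>

lemma inverse_Im_geodesic_le:
  assumes A: "det A = 1" and t: "t \<ge> 1"
  shows "Im (geodesic A t) > 0" "1 + 1 / Im (geodesic A t) \<le> (1 + (A $ 2 $ 1)\<^sup>2 + (A $ 2 $ 2)\<^sup>2) * t"
proof -
  define c d where "c = A $ 2 $ 1" and "d = A $ 2 $ 2"
  have pos: "c\<^sup>2 * t\<^sup>2 + d\<^sup>2 > 0"
    using geodesic_denominator_pos[OF A, of t] t by (simp add: c_def d_def)
  then show "Im (geodesic A t) > 0"
    unfolding Im_geodesic[OF A] using t by (simp add: c_def d_def)
  have "1 / Im (geodesic A t) = c\<^sup>2 * t + d\<^sup>2 / t"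
    unfolding Im_geodesic[OF A] c_def[symmetric] d_def[symmetric] using t pos
    by (simp add: field_simps power2_eq_square)
  also have "d\<^sup>2 / t \<le> d\<^sup>2 * t"
  proof -
    have "d\<^sup>2 / t \<le> d\<^sup>2 / 1" using t by (intro divide_left_mono) auto
    also have "\<dots> \<le> d\<^sup>2 * t" using t mult_left_mono[of 1 t "d\<^sup>2"] by simp
    finally show ?thesis .
  qed
  finally show "1 + 1 / Im (geodesic A t) \<le> (1 + (A $ 2 $ 1)\<^sup>2 + (A $ 2 $ 2)\<^sup>2) * t"
    using t by (simp add: c_def d_def algebra_simps)
qed

lemma norm_higher_deriv_twisted_sigma:
  obtains B C where "B \<ge> 0" "C \<ge> 1" "\<And>\<tau> l. Im \<tau> > 0 \<Longrightarrow>
    norm ((deriv ^^ l) (twisted_sigma k \<tau>) 0) \<le> fact l * B * (C * (1 + 1 / Im \<tau>)\<^sup>2) ^ l"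
proof -
  obtain C where C: "C \<ge> 1"
    "\<And>\<tau> z. Im \<tau> > 0 \<Longrightarrow> norm z \<le> 1 / (C * (1 + 1 / Im \<tau>)\<^sup>2) \<Longrightarrow> norm (sigma \<tau> z) \<le> exp 1"
    using sigma_bounded_near_0 by blast
  define B where "B = exp pi ^ k * exp 1"
  have "norm ((deriv ^^ l) (twisted_sigma k \<tau>) 0) \<le> fact l * B * (C * (1 + 1 / Im \<tau>)\<^sup>2) ^ l"
    if \<tau>: "Im \<tau> > 0" for \<tau> l
  proof -
    define R where "R = C * (1 + 1 / Im \<tau>)\<^sup>2"
    have R: "R \<ge> 1" using mult_mono[of 1 C 1 "(1 + 1 / Im \<tau>)\<^sup>2"] C(1) \<tau> by (simp add: R_def one_le_power)
    have "norm ((deriv ^^ l) (twisted_sigma k \<tau>) 0) \<le> fact l * B / (1 / R) ^ l"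
    proof (rule Cauchy_inequality)
      show "continuous_on (cball 0 (1 / R)) (twisted_sigma k \<tau>)"
        by (rule holomorphic_on_imp_continuous_on[OF twisted_sigma_holomorphic[OF \<tau>]])
      fix x :: complex assume "norm (0 - x) = 1 / R"
      then have x: "norm x = 1 / R" by simp
      then have "norm (sigma \<tau> x) \<le> exp 1" using C(2)[OF \<tau>] by (simp add: R_def)
      moreover have "norm (- epi x) \<le> exp pi"
      proof -
        have "\<bar>Im x\<bar> \<le> 1" using abs_Im_le_cmod[of x] x R by (simp add: order_trans[of _ "1 / R"])
        then have "- (pi * Im x) \<le> pi" using mult_left_mono[of "- Im x" 1 pi] by simp
        then show ?thesis by (simp add: epi_def)
      qed
      ultimately show "norm (twisted_sigma k \<tau> x) \<le> B"
        unfolding twisted_sigma_def norm_mult norm_power B_def by (intro mult_mono power_mono) auto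
    qed (use R in \<open>auto intro: twisted_sigma_holomorphic[OF \<tau>]\<close>)
    then show ?thesis by (simp add: R_def power_divide)
  qed
  then show ?thesis using that[of B C] C(1) by (simp add: B_def)
qed

lemma poly_growth_sigma_prod: "poly_growth V (sigma_prod k)"
  unfolding poly_growth_def
proof (intro allI impI)
  fix A :: "real ^ 2 ^ 2" and "is" :: "'a list"
  assume A: "det A = 1"
  obtain B C where BC: "B \<ge> 0" "C \<ge> 1" "\<And>\<tau> l. Im \<tau> > 0 \<Longrightarrow>
      norm ((deriv ^^ l) (twisted_sigma k \<tau>) 0) \<le> fact l * B * (C * (1 + 1 / Im \<tau>)\<^sup>2) ^ l"
    using norm_higher_deriv_twisted_sigma[of k] by blast
  define M where "M = 1 + (A $ 2 $ 1)\<^sup>2 + (A $ 2 $ 2)\<^sup>2"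
  define l where "l = count_list is"
  define K where "K = (\<Prod>j\<in>UNIV. fact (l j) * B * (C * M\<^sup>2) ^ l j)"
  define N where "N = (\<Sum>j\<in>UNIV. 2 * l j)"
  have bound: "norm (foldr partial_z is (sigma_prod k) (geodesic A t, 0)) \<le> K * t ^ N" if t: "t \<ge> 1" for t
  proof -
    define \<tau> where "\<tau> = geodesic A t"
    have \<tau>: "Im \<tau> > 0" "1 + 1 / Im \<tau> \<le> M * t"
      using inverse_Im_geodesic_le[OF A t] by (simp_all add: \<tau>_def M_def)
    have "foldr partial_z is (sigma_prod k) (\<tau>, 0) = (\<Prod>j\<in>UNIV. (deriv ^^ l j) (twisted_sigma k \<tau>) (0 $ j))"
      unfolding l_def by (intro foldr_partial_z_prod twisted_sigma_holomorphic \<tau>) (simp add: sigma_prod_def)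
    then have "norm (foldr partial_z is (sigma_prod k) (\<tau>, 0)) =
        (\<Prod>j\<in>UNIV. norm ((deriv ^^ l j) (twisted_sigma k \<tau>) 0))"
      by (simp add: prod_norm)
    also have "\<dots> \<le> (\<Prod>j\<in>UNIV. fact (l j) * B * (C * M\<^sup>2) ^ l j * t ^ (2 * l j))"
    proof (intro prod_mono conjI)
      fix j
      have "norm ((deriv ^^ l j) (twisted_sigma k \<tau>) 0) \<le> fact (l j) * B * (C * (1 + 1 / Im \<tau>)\<^sup>2) ^ l j"
        by (rule BC(3)[OF \<tau>(1)])
      also have "\<dots> \<le> fact (l j) * B * (C * (M * t)\<^sup>2) ^ l j"
        using BC \<tau> by (intro mult_left_mono power_mono mult_nonneg_nonneg) auto
      also have "\<dots> = fact (l j) * B * (C * M\<^sup>2) ^ l j * t ^ (2 * l j)"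
        by (simp add: power_mult_distrib power_mult[symmetric] mult_ac)
      finally show "norm ((deriv ^^ l j) (twisted_sigma k \<tau>) 0) \<le> fact (l j) * B * (C * M\<^sup>2) ^ l j * t ^ (2 * l j)" .
    qed auto
    also have "\<dots> = K * t ^ N" by (simp add: K_def N_def prod.distrib power_sum)
    finally show ?thesis by (simp add: \<tau>_def)
  qed
  have "(\<lambda>t. norm (foldr partial_z is (sigma_prod k) (geodesic A t, 0))) \<in> O(\<lambda>t. t ^ N)"
  proof (rule bigoI[where c = "\<bar>K\<bar>"])
    show "\<forall>\<^sub>F t in at_top. norm (norm (foldr partial_z is (sigma_prod k) (geodesic A t, 0))) \<le> \<bar>K\<bar> * norm (t ^ N)"
      using eventually_ge_at_top[of "1::real"]
    proof eventually_elim
      case (elim t)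
      have "norm (foldr partial_z is (sigma_prod k) (geodesic A t, 0)) \<le> K * t ^ N" by (rule bound[OF elim])
      also have "\<dots> \<le> \<bar>K\<bar> * norm (t ^ N)" using abs_ge_self[of "K * t ^ N"] by (simp add: abs_mult)
      finally show ?case by simp
    qed
  qed
  then show "\<exists>N. (\<lambda>t. norm (foldr partial_z is (sigma_prod k) (geodesic A t, 0))) \<in> O(\<lambda>t. t ^ N)" ..
qed

text \<open>
  Every geodesic leaves a compact part of the upper half plane, since its imaginary part tends to 0 or
  to infinity, so over such a part the growth condition is vacuous.
\<close>

lemma poly_growth_bounded:
  assumes \<tau>0: "Im \<tau>0 > 0" and V: "\<And>p. p \<in> V \<Longrightarrow> fst p \<in> ball \<tau>0 (Im \<tau>0 / 2)"
  shows "poly_growth V f"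
  unfolding poly_growth_def
proof (intro allI impI)
  fix A :: "real ^ 2 ^ 2" and "is" :: "'a list"
  assume A: "det A = 1" and ev: "\<forall>\<^sub>F t in at_top. (geodesic A t, 0) \<in> V"
  define c d where "c = A $ 2 $ 1" and "d = A $ 2 $ 2"
  have "\<forall>\<^sub>F t in at_top. Im \<tau>0 / 2 < t / (c\<^sup>2 * t\<^sup>2 + d\<^sup>2) \<and> t / (c\<^sup>2 * t\<^sup>2 + d\<^sup>2) < 2 * Im \<tau>0"
    using ev
  proof eventually_elim
    case (elim t)
    then have "dist \<tau>0 (geodesic A t) < Im \<tau>0 / 2" using V by fastforce
    then have "\<bar>Im (\<tau>0 - geodesic A t)\<bar> < Im \<tau>0 / 2"
      using abs_Im_le_cmod[of "\<tau>0 - geodesic A t"] by (simp add: dist_norm)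
    then have "\<bar>Im \<tau>0 - t / (c\<^sup>2 * t\<^sup>2 + d\<^sup>2)\<bar> < Im \<tau>0 / 2"
      by (simp only: minus_complex.sel Im_geodesic[OF A] c_def d_def)
    then show ?case using \<tau>0 by linarith
  qed
  moreover have "\<forall>\<^sub>F t in at_top. t > max 1 (max (2 * Im \<tau>0 * d\<^sup>2) (2 / (c\<^sup>2 * Im \<tau>0)))"
    by (rule eventually_gt_at_top)
  ultimately have "\<forall>\<^sub>F t::real in at_top. False"
  proof eventually_elim
    case (elim t)
    show False
    proof (cases "c = 0")
      case True
      then have "d\<^sup>2 > 0" using A by (auto simp: det_2 c_def d_def)
      then show False using elim True by (simp add: field_simps)
    next
      case False
      then have c2: "c\<^sup>2 > 0" by simp
      have "t / (c\<^sup>2 * t\<^sup>2 + d\<^sup>2) \<le> t / (c\<^sup>2 * t\<^sup>2)"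
        using elim c2 by (intro divide_left_mono) (auto intro!: mult_pos_pos add_pos_nonneg)
      also have "\<dots> = 1 / (c\<^sup>2 * t)" using elim by (simp add: power2_eq_square)
      also have "\<dots> < Im \<tau>0 / 2" using elim c2 \<tau>0 by (simp add: field_simps)
      finally show False using elim by simp
    qed
  qed
  then show "\<exists>N. (\<lambda>t. norm (foldr partial_z is f (geodesic A t, 0))) \<in> O(\<lambda>t. t ^ N)" by simp
qed


section \<open>Sections of the line bundle\<close>

lemma const_mult: "const (a * b) = const a * const b"
  by (simp add: const_def mult_single)

lemma const_sum: "const (\<Sum>i\<in>I. f i) = (\<Sum>i\<in>I. const (f i))"
  by (induction I rule: infinite_finite_induct) (auto simp: const_def single_add)

lemma const_1 [simp]: "const 1 = 1"
  by (simp add: const_def)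

lemma const_eq_iff [simp]: "const a = const b \<longleftrightarrow> a = b"
  unfolding const_def by (metis lookup_single_eq)

definition equivariant_on :: "('n::finite) lie_data \<Rightarrow> ('n jac \<Rightarrow> 'n pt \<Rightarrow> complex) \<Rightarrow> 'n pt set \<Rightarrow> ('n pt \<Rightarrow> complex) \<Rightarrow> bool"
  where "equivariant_on G j V f \<longleftrightarrow>
    (\<forall>w\<in>weyl G. \<forall>(\<tau>, z)\<in>V. f (\<tau>, weyl_act w z) = f (\<tau>, z)) \<and>
    (\<forall>m\<in>cochar G. \<forall>n\<in>cochar G. \<forall>p\<in>V. f (jacobi_act (translation m n) p) = j (translation m n) p * f p)"

lemma equivariant_onD:
  assumes "equivariant_on G j V f"
  shows "w \<in> weyl G \<Longrightarrow> (\<tau>, z) \<in> V \<Longrightarrow> f (\<tau>, weyl_act w z) = f (\<tau>, z)"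
    "m \<in> cochar G \<Longrightarrow> n \<in> cochar G \<Longrightarrow> p \<in> V \<Longrightarrow>
      f (jacobi_act (translation m n) p) = j (translation m n) p * f p"
  using assms unfolding equivariant_on_def by blast+

lemma equivariant_onI:
  assumes "\<And>w \<tau> z. w \<in> weyl G \<Longrightarrow> (\<tau>, z) \<in> V \<Longrightarrow> f (\<tau>, weyl_act w z) = f (\<tau>, z)"
    "\<And>m n p. m \<in> cochar G \<Longrightarrow> n \<in> cochar G \<Longrightarrow> p \<in> V \<Longrightarrow>
      f (jacobi_act (translation m n) p) = j (translation m n) p * f p"
  shows "equivariant_on G j V f"
  using assms unfolding equivariant_on_def by blast

lemma equivariant_on_mult:
  assumes "equivariant_on G j V f" "equivariant_on G (\<lambda>_ _. 1) V g"
  shows "equivariant_on G j V (\<lambda>p. f p * g p)"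
  by (rule equivariant_onI) (simp_all only: equivariant_onD[OF assms(1)] equivariant_onD[OF assms(2)] mult_ac mult_1)

lemma secs_automorphic_sheaf:
  "\<Phi> \<in> secs (automorphic_sheaf G j) V \<longleftrightarrow>
    (\<exists>f\<in>hol V. (\<forall>p\<in>V. \<Phi> p = const (f p)) \<and> equivariant_on G j V f)"
  by (simp add: automorphic_sheaf_def equivariant_on_def)

lemma secs_structure_sheaf:
  "\<Phi> \<in> secs (structure_sheaf G) V \<longleftrightarrow>
    (\<exists>f\<in>hol V. (\<forall>p\<in>V. \<Phi> p = const (f p)) \<and> equivariant_on G (\<lambda>_ _. 1) V f)"
  by (simp add: structure_sheaf_def secs_automorphic_sheaf)

lemma secs_omega:
  "\<Phi> \<in> secs (omega G k) V \<longleftrightarrow>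
    (\<exists>f\<in>hol V. (\<forall>p\<in>V. \<Phi> p = const (f p)) \<and> equivariant_on G (\<lambda>_ _. 1) V f)"
  unfolding omega_def secs_automorphic_sheaf equivariant_on_def by simp

lemma const_1_secs_omega: "(\<lambda>_. 1) \<in> secs (omega G k) V"
  unfolding secs_omega
  by (rule bexI[of _ "\<lambda>_. 1"]) (auto simp: equivariant_on_def hol_def poly_growth_const)

lemma secs_tensor_product:
  assumes "a \<in> secs F V" "b \<in> secs E V"
  shows "(\<lambda>p. a p * b p) \<in> secs (tensor F E) V"
proof -
  have "\<exists>(k::nat) a' b'. (\<forall>i<k. a' i \<in> secs F V \<and> b' i \<in> secs E V) \<and>
      (\<forall>p\<in>V. a p * b p = (\<Sum>i<k. a' i p * b' i p))"
    using assms by (intro exI[of _ "1::nat"] exI[of _ "\<lambda>_::nat. a"] exI[of _ "\<lambda>_::nat. b"]) simp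
  then show ?thesis by (simp add: tensor_def)
qed

lemma secs_L_sheaf_I:
  assumes "\<Phi> \<in> secs (A_sheaf G s) V"
  shows "\<Phi> \<in> secs (L_sheaf G s) V"
  using secs_tensor_product[OF assms const_1_secs_omega] by (simp add: L_sheaf_def)

lemma equivariant_on_cong:
  assumes "\<And>m n p. m \<in> cochar G \<Longrightarrow> n \<in> cochar G \<Longrightarrow> p \<in> V \<Longrightarrow> j (translation m n) p = j' (translation m n) p"
  shows "equivariant_on G j V f \<longleftrightarrow> equivariant_on G j' V f"
  unfolding equivariant_on_def using assms by simp

lemma secs_A_sheaf:
  assumes G: "compatible k G" and V: "V \<subseteq> atlas"
  shows "\<Phi> \<in> secs (A_sheaf G (sigma_prod k)) V \<longleftrightarrow>
    (\<exists>f\<in>hol V. (\<forall>p\<in>V. \<Phi> p = const (f p)) \<and> equivariant_on G (jacobi_factor k) V f)"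
proof -
  have "equivariant_on G (cocycle_of G (sigma_prod k)) V f \<longleftrightarrow> equivariant_on G (jacobi_factor k) V f" for f
    using V by (intro equivariant_on_cong cocycle_of_eq[OF G]) (auto simp: jacobi_group_def)
  then show ?thesis unfolding A_sheaf_def secs_automorphic_sheaf by simp
qed

text \<open>
  The sections of \<open>omega\<close> are invariant functions on the atlas, so tensoring with it changes only the
  action of the modular group. The assumption on \<open>hol V\<close> holds for the small sets on which local
  freeness is tested; there sums and products need no growth estimates.
\<close>

lemma secs_L_sheaf:
  assumes G: "compatible k G" and V: "V \<subseteq> atlas" and hol: "hol V = {f. \<forall>p\<in>V. holomorphic_at f p}"
  shows "\<Phi> \<in> secs (L_sheaf G (sigma_prod k)) V \<longleftrightarrow>
    (\<exists>f\<in>hol V. (\<forall>p\<in>V. \<Phi> p = const (f p)) \<and> equivariant_on G (jacobi_factor k) V f)"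
proof
  assume "\<Phi> \<in> secs (L_sheaf G (sigma_prod k)) V"
  then obtain N :: nat and a b where ab: "\<And>i. i < N \<Longrightarrow> a i \<in> secs (A_sheaf G (sigma_prod k)) V"
      "\<And>i. i < N \<Longrightarrow> b i \<in> secs (omega G CARD('a)) V" and \<Phi>: "\<And>p. p \<in> V \<Longrightarrow> \<Phi> p = (\<Sum>i<N. a i p * b i p)"
    unfolding L_sheaf_def tensor_def by simp blast
  have "\<forall>i\<in>{..<N}. \<exists>f. f \<in> hol V \<and> (\<forall>p\<in>V. a i p = const (f p)) \<and> equivariant_on G (jacobi_factor k) V f"
    using ab(1) unfolding secs_A_sheaf[OF G V] by blast
  then obtain f where f: "\<And>i. i < N \<Longrightarrow> f i \<in> hol V \<and> (\<forall>p\<in>V. a i p = const (f i p)) \<and> equivariant_on G (jacobi_factor k) V (f i)"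
    by (metis lessThan_iff)
  have "\<forall>i\<in>{..<N}. \<exists>f. f \<in> hol V \<and> (\<forall>p\<in>V. b i p = const (f p)) \<and> equivariant_on G (\<lambda>_ _. 1) V f"
    using ab(2) unfolding secs_omega by blast
  then obtain g where g: "\<And>i. i < N \<Longrightarrow> g i \<in> hol V \<and> (\<forall>p\<in>V. b i p = const (g i p)) \<and> equivariant_on G (\<lambda>_ _. 1) V (g i)"
    by (metis lessThan_iff)
  define F where "F = (\<lambda>p. \<Sum>i<N. f i p * g i p)"
  have "F \<in> hol V"
    using f g unfolding hol F_def by (auto intro!: holomorphic_at_sum holomorphic_at_mult)
  moreover have "\<forall>p\<in>V. \<Phi> p = const (F p)"
    using f g \<Phi> by (auto simp: F_def const_sum const_mult)
  moreover have "equivariant_on G (jacobi_factor k) V F"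
  proof -
    have fg: "equivariant_on G (jacobi_factor k) V (\<lambda>p. f i p * g i p)" if "i < N" for i
      using f[OF that] g[OF that] by (intro equivariant_on_mult) auto
    show ?thesis
    proof (rule equivariant_onI)
      show "F (\<tau>, weyl_act w z) = F (\<tau>, z)" if "w \<in> weyl G" "(\<tau>, z) \<in> V" for w \<tau> z
        unfolding F_def using equivariant_onD(1)[OF fg that] by (intro sum.cong) auto
      show "F (jacobi_act (translation m n) p) = jacobi_factor k (translation m n) p * F p"
        if "m \<in> cochar G" "n \<in> cochar G" "p \<in> V" for m n p
        unfolding F_def sum_distrib_left using equivariant_onD(2)[OF fg that] by (intro sum.cong) auto
    qed
  qed
  ultimately show "\<exists>f\<in>hol V. (\<forall>p\<in>V. \<Phi> p = const (f p)) \<and> equivariant_on G (jacobi_factor k) V f" by blast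
next
  assume "\<exists>f\<in>hol V. (\<forall>p\<in>V. \<Phi> p = const (f p)) \<and> equivariant_on G (jacobi_factor k) V f"
  then show "\<Phi> \<in> secs (L_sheaf G (sigma_prod k)) V"
    by (intro secs_L_sheaf_I) (simp add: secs_A_sheaf[OF G V])
qed


section \<open>Local generators\<close>

text \<open>
  A quotient of shifted theta functions, a section without zeros near points that may be zeros of
  \<open>sigma\<close> itself: the shifts cancel because \<open>a + a - 2 a = 0\<close>, so that the quotient has the quasi-periods
  of \<open>sigma\<close>. The same shift \<open>a\<close> in all coordinates keeps it symmetric under permutations.
\<close>

definition local_generator :: "nat \<Rightarrow> complex \<Rightarrow> ('n::finite) pt \<Rightarrow> complex"
  where "local_generator k a p = (\<Prod>j\<in>UNIV. (- epi (snd p $ j)) ^ k *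
    ((sigma (fst p) (snd p $ j - a))\<^sup>2 / sigma (fst p) (snd p $ j - 2 * a)))"

definition generator_domain :: "complex \<Rightarrow> complex \<Rightarrow> ('n::finite) pt set"
  where "generator_domain \<tau>0 a = {p. fst p \<in> ball \<tau>0 (Im \<tau>0 / 2) \<and>
    (\<forall>j. sigma (fst p) (snd p $ j - a) \<noteq> 0 \<and> sigma (fst p) (snd p $ j - 2 * a) \<noteq> 0)}"

lemma Im_pos_near:
  assumes "\<tau> \<in> ball \<tau>0 (Im \<tau>0 / 2)"
  shows "Im \<tau> > 0"
proof -
  have "\<bar>Im (\<tau>0 - \<tau>)\<bar> < Im \<tau>0 / 2"
    using abs_Im_le_cmod[of "\<tau>0 - \<tau>"] assms by (simp add: dist_norm)
  then show ?thesis unfolding minus_complex.sel by linarith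
qed

text \<open>
  Each coordinate excludes only countably many shifts, as the zeros of \<open>sigma \<tau>\<close> form a lattice.
\<close>

lemma exists_generic_shift:
  fixes z :: "complex ^ ('n::finite)"
  assumes "Im \<tau> > 0"
  shows "\<exists>a. \<forall>j. sigma \<tau> (z $ j - a) \<noteq> 0 \<and> sigma \<tau> (z $ j - 2 * a) \<noteq> 0"
proof (rule ccontr)
  assume "\<not> ?thesis"
  then have "UNIV \<subseteq> (\<Union>j. (\<lambda>x. z $ j - x) ` {x. sigma \<tau> x = 0} \<union> (\<lambda>x. (z $ j - x) / 2) ` {x. sigma \<tau> x = 0})"
  proof (intro subsetI)
    fix a assume "\<not> (\<exists>a. \<forall>j. sigma \<tau> (z $ j - a) \<noteq> 0 \<and> sigma \<tau> (z $ j - 2 * a) \<noteq> 0)"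
    then obtain j where "sigma \<tau> (z $ j - a) = 0 \<or> sigma \<tau> (z $ j - 2 * a) = 0" by blast
    moreover have "a = z $ j - (z $ j - a)" "a = (z $ j - (z $ j - 2 * a)) / 2" by simp_all
    ultimately show "a \<in> (\<Union>j. (\<lambda>x. z $ j - x) ` {x. sigma \<tau> x = 0} \<union> (\<lambda>x. (z $ j - x) / 2) ` {x. sigma \<tau> x = 0})"
      by blast
  qed
  moreover have "countable (\<Union>j. (\<lambda>x. z $ j - x) ` {x. sigma \<tau> x = 0} \<union> (\<lambda>x. (z $ j - x) / 2) ` {x. sigma \<tau> x = 0})"
    using countable_sigma_zeros[OF assms] by (intro countable_UN countable_Un countable_image) auto
  ultimately show False using uncountable_UNIV_complex countable_subset by blast
qed

lemma open_generator_domain: "open (generator_domain \<tau>0 a :: ('n::finite) pt set)"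
proof (rule Topological_Spaces.openI)
  fix p :: "'n pt" assume p: "p \<in> generator_domain \<tau>0 a"
  then have \<tau>: "Im (fst p) > 0" using Im_pos_near by (auto simp: generator_domain_def)
  have "isCont (\<lambda>p :: 'n pt. sigma (fst p) (snd p $ j - c)) p" for j c
    using \<tau> by (intro holomorphic_at_isCont holomorphic_at_intros)
  then have ev: "\<forall>\<^sub>F q in nhds p. sigma (fst q) (snd q $ j - c) \<noteq> 0" if "sigma (fst p) (snd p $ j - c) \<noteq> 0" for j c
    using that tendsto_imp_eventually_ne[of "\<lambda>q. sigma (fst q) (snd q $ j - c)" "sigma (fst p) (snd p $ j - c)" "at p" 0]
    by (simp add: eventually_nhds_conv_at isCont_def)
  have "\<forall>\<^sub>F q in nhds p. \<forall>j\<in>UNIV. sigma (fst q) (snd q $ j - a) \<noteq> 0 \<and> sigma (fst q) (snd q $ j - 2 * a) \<noteq> 0"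
    using p by (intro eventually_ball_finite ballI eventually_conj ev) (auto simp: generator_domain_def)
  moreover have "\<forall>\<^sub>F q in nhds p. fst q \<in> ball \<tau>0 (Im \<tau>0 / 2)"
  proof -
    have "p \<in> ball \<tau>0 (Im \<tau>0 / 2) \<times> UNIV"
      using p by (simp add: generator_domain_def mem_Times_iff)
    then have "\<forall>\<^sub>F q in nhds p. q \<in> ball \<tau>0 (Im \<tau>0 / 2) \<times> UNIV"
      by (intro eventually_nhds_in_open open_Times) auto
    then show ?thesis by (simp add: mem_Times_iff)
  qed
  ultimately have "\<forall>\<^sub>F q in nhds p. q \<in> generator_domain \<tau>0 a"
    by eventually_elim (simp add: generator_domain_def)
  then show "\<exists>T. open T \<and> p \<in> T \<and> T \<subseteq> generator_domain \<tau>0 a"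
    unfolding eventually_nhds by blast
qed

lemma generator_transform_coord:
  assumes \<tau>: "Im \<tau> > 0"
  shows "(- epi (z + of_int m + of_int n * \<tau>)) ^ k *
      ((sigma \<tau> (z + of_int m + of_int n * \<tau> - a))\<^sup>2 / sigma \<tau> (z + of_int m + of_int n * \<tau> - 2 * a)) =
    coord_factor k m n (mat 1) \<tau> z * ((- epi z) ^ k * ((sigma \<tau> (z - a))\<^sup>2 / sigma \<tau> (z - 2 * a)))"
proof -
  have s: "sigma \<tau> (z + of_int m + of_int n * \<tau> - b) =
      epi (of_int m + of_int n - of_int n ^ 2 * \<tau> - 2 * of_int n * z) * epi (2 * of_int n * b) * sigma \<tau> (z - b)" for b
    using sigma_quasi_periodic[OF \<tau>, of "z - b" m n] unfolding epi_add[symmetric]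
    by (simp add: algebra_simps)
  have c0: "(mat 1 :: int ^ 2 ^ 2) $ 2 $ 1 = 0" by (simp add: mat_def)
  have e: "(epi (2 * of_int n * a))\<^sup>2 = epi (2 * of_int n * (2 * a))"
    unfolding power2_eq_square epi_add[symmetric] by (rule arg_cong[of _ _ epi]) simp
  show ?thesis
    unfolding s coord_factor_def power_mult_distrib e
    by (simp add: c0 power2_eq_square)
qed

text \<open>
  Division by the local generator. Its symmetry under permutations, but not under sign changes, is
  what restricts the Weyl group here.
\<close>

theorem locally_free_L_sheaf:
  fixes G :: "('n::finite) lie_data"
  assumes G: "compatible k G" and perm: "\<And>w i. w \<in> weyl G \<Longrightarrow> fst w i = 1"
  shows "locally_free_rank_one G (L_sheaf G (sigma_prod k))"
  unfolding locally_free_rank_one_def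
proof (intro ballI)
  fix p :: "'n pt" assume p: "p \<in> atlas"
  define \<tau>0 where "\<tau>0 = fst p"
  have \<tau>0: "Im \<tau>0 > 0" using p by (simp add: \<tau>0_def atlas_iff)
  obtain a where a: "\<And>j. sigma \<tau>0 (snd p $ j - a) \<noteq> 0 \<and> sigma \<tau>0 (snd p $ j - 2 * a) \<noteq> 0"
    using exists_generic_shift[OF \<tau>0, of "snd p"] by blast
  define V :: "'n pt set" where "V = generator_domain \<tau>0 a"
  define s :: "'n pt \<Rightarrow> complex" where "s = local_generator k a"
  have Im: "Im (fst q) > 0" if "q \<in> V" for q
    using that Im_pos_near by (auto simp: V_def generator_domain_def)
  have Vnz: "sigma (fst q) (snd q $ j - a) \<noteq> 0" "sigma (fst q) (snd q $ j - 2 * a) \<noteq> 0" if "q \<in> V" for q j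
    using that by (auto simp: V_def generator_domain_def)
  have bij: "bij (snd w)" if "w \<in> weyl G" for w using G that by (auto simp: compatible_def)
  have act: "weyl_act w z $ i = z $ snd w i" if "w \<in> weyl G" for w i and z :: "complex ^ 'n"
    using perm[OF that] by (simp add: weyl_act_def)
  have tr: "jacobi_act (translation m n) q = (fst q, \<chi> i. snd q $ i + of_int (m $ i) + of_int (n $ i) * fst q)" for m n and q :: "'n pt"
    by (cases q) simp
  have V: "V \<in> opens G"
    unfolding opens_def
  proof (intro CollectI conjI ballI)
    show "open V" unfolding V_def by (rule open_generator_domain)
    show "V \<subseteq> atlas" using Im by (auto simp: atlas_iff)
    fix w q assume "w \<in> weyl G" "q \<in> V"
    then show "case q of (\<tau>, z) \<Rightarrow> (\<tau>, weyl_act w z) \<in> V"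
      by (auto simp: V_def generator_domain_def act)
  next
    fix m n q assume q: "q \<in> V"
    have nz: "sigma (fst q) (snd q $ j + of_int (m $ j) + of_int (n $ j) * fst q - b) \<noteq> 0"
      if "sigma (fst q) (snd q $ j - b) \<noteq> 0" for j b
      using sigma_quasi_periodic[OF Im[OF q], of "snd q $ j - b" "m $ j" "n $ j"] that
      by (simp add: algebra_simps)
    show "jacobi_act (translation m n) q \<in> V"
      using q nz unfolding tr V_def generator_domain_def by simp
  qed
  have pV: "p \<in> V" using a \<tau>0 by (simp add: V_def generator_domain_def \<tau>0_def)
  have s_nz: "s q \<noteq> 0" if "q \<in> V" for q
    using Vnz[OF that] by (simp add: s_def local_generator_def)
  have s_hol: "holomorphic_at s q" if "q \<in> V" for q
    unfolding s_def local_generator_def[abs_def] using Vnz[OF that] Im[OF that]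
    by (intro holomorphic_at_intros) auto
  have s_eq: "equivariant_on G (jacobi_factor k) V' s" if "V' \<subseteq> V" for V'
  proof (rule equivariant_onI)
    fix w \<tau> z assume w: "w \<in> weyl G"
    show "s (\<tau>, weyl_act w z) = s (\<tau>, z)"
      using prod_permute[OF bij[OF w], of "\<lambda>j. (- epi (z $ j)) ^ k * ((sigma \<tau> (z $ j - a))\<^sup>2 / sigma \<tau> (z $ j - 2 * a))"]
      by (simp add: s_def local_generator_def act[OF w])
  next
    fix m n q assume "q \<in> V'"
    then have "Im (fst q) > 0" using that Im by blast
    then show "s (jacobi_act (translation m n) q) = jacobi_factor k (translation m n) q * s q"
      unfolding tr s_def local_generator_def fst_conv snd_conv vec_lambda_beta jacobi_factor.simps
      by (simp only: generator_transform_coord prod.distrib)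
  qed
  have main: "(\<forall>\<Phi>. \<Phi> \<in> secs (L_sheaf G (sigma_prod k)) V' \<longleftrightarrow>
        (\<exists>c\<in>secs (structure_sheaf G) V'. \<forall>q\<in>V'. \<Phi> q = c q * const (s q)))"
      "(\<forall>c\<in>secs (structure_sheaf G) V'. \<forall>c'\<in>secs (structure_sheaf G) V'.
        (\<forall>q\<in>V'. c q * const (s q) = c' q * const (s q)) \<longrightarrow> (\<forall>q\<in>V'. c q = c' q))"
    if V': "V' \<in> opens G" "V' \<subseteq> V" for V'
  proof -
    have atl: "V' \<subseteq> atlas" using V'(1) by (simp add: opens_def)
    have inv: "(\<tau>, weyl_act w z) \<in> V'" if "w \<in> weyl G" "(\<tau>, z) \<in> V'" for w \<tau> z
      using V'(1) that unfolding opens_def by fastforce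
    have inv': "jacobi_act (translation m n) q \<in> V'" if "m \<in> cochar G" "n \<in> cochar G" "q \<in> V'" for m n q
      using V'(1) that unfolding opens_def by blast
    have hol: "hol V' = {f. \<forall>p\<in>V'. holomorphic_at f p}"
    proof -
      have "poly_growth V' f" for f
        using V'(2) by (intro poly_growth_bounded[OF \<tau>0]) (auto simp: V_def generator_domain_def)
      then show ?thesis by (simp add: hol_def)
    qed
    show "(\<forall>\<Phi>. \<Phi> \<in> secs (L_sheaf G (sigma_prod k)) V' \<longleftrightarrow>
        (\<exists>c\<in>secs (structure_sheaf G) V'. \<forall>q\<in>V'. \<Phi> q = c q * const (s q)))"
    proof (intro allI iffI)
      fix \<Phi> assume "\<Phi> \<in> secs (L_sheaf G (sigma_prod k)) V'"
      then obtain f where f: "f \<in> hol V'" "\<And>q. q \<in> V' \<Longrightarrow> \<Phi> q = const (f q)" "equivariant_on G (jacobi_factor k) V' f"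
        unfolding secs_L_sheaf[OF G atl hol] by blast
      define c where "c = (\<lambda>q. f q / s q)"
      have "c \<in> hol V'"
        using f(1) s_hol s_nz V'(2) unfolding hol c_def by (auto intro!: holomorphic_at_divide)
      moreover have "equivariant_on G (\<lambda>_ _. 1) V' c"
      proof (rule equivariant_onI)
        show "c (\<tau>, weyl_act w z) = c (\<tau>, z)" if "w \<in> weyl G" "(\<tau>, z) \<in> V'" for w \<tau> z
          unfolding c_def by (simp only: equivariant_onD(1)[OF f(3) that] equivariant_onD(1)[OF s_eq[OF V'(2)] that])
      next
        fix m n q assume mn: "m \<in> cochar G" "n \<in> cochar G" "q \<in> V'"
        then have "jacobi_factor k (translation m n) q \<noteq> 0" using atl by (intro jacobi_factor_nonzero) auto
        then show "c (jacobi_act (translation m n) q) = 1 * c q"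
          unfolding c_def equivariant_onD(2)[OF f(3) mn] equivariant_onD(2)[OF s_eq[OF V'(2)] mn] by simp
      qed
      ultimately have "(\<lambda>q. const (c q)) \<in> secs (structure_sheaf G) V'"
        unfolding secs_structure_sheaf by blast
      moreover have "\<forall>q\<in>V'. \<Phi> q = const (c q) * const (s q)"
        using f(2) s_nz V'(2) by (auto simp: c_def const_mult[symmetric])
      ultimately show "\<exists>c\<in>secs (structure_sheaf G) V'. \<forall>q\<in>V'. \<Phi> q = c q * const (s q)"
        by (intro bexI[of _ "\<lambda>q. const (c q)"])
    next
      fix \<Phi> assume "\<exists>c\<in>secs (structure_sheaf G) V'. \<forall>q\<in>V'. \<Phi> q = c q * const (s q)"
      then obtain c where c: "c \<in> secs (structure_sheaf G) V'" "\<And>q. q \<in> V' \<Longrightarrow> \<Phi> q = c q * const (s q)"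
        by blast
      from c(1) obtain f where f: "f \<in> hol V'" "\<And>q. q \<in> V' \<Longrightarrow> \<Phi> q = const (f q) * const (s q)"
          "equivariant_on G (\<lambda>_ _. 1) V' f"
        unfolding secs_structure_sheaf using c(2) by fastforce
      have "(\<lambda>q. s q * f q) \<in> hol V'"
        using f(1) s_hol V'(2) unfolding hol by (auto intro!: holomorphic_at_mult)
      moreover have "\<forall>q\<in>V'. \<Phi> q = const (s q * f q)"
        using f(2) by (simp add: const_mult mult.commute)
      ultimately show "\<Phi> \<in> secs (L_sheaf G (sigma_prod k)) V'"
        unfolding secs_L_sheaf[OF G atl hol] using equivariant_on_mult[OF s_eq[OF V'(2)] f(3)]
        by (intro bexI[of _ "\<lambda>q. s q * f q"] conjI)
    qed
    show "(\<forall>c\<in>secs (structure_sheaf G) V'. \<forall>c'\<in>secs (structure_sheaf G) V'.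
        (\<forall>q\<in>V'. c q * const (s q) = c' q * const (s q)) \<longrightarrow> (\<forall>q\<in>V'. c q = c' q))"
    proof (intro ballI impI)
      fix c c' q assume c: "c \<in> secs (structure_sheaf G) V'" "c' \<in> secs (structure_sheaf G) V'"
        and eq: "\<forall>q\<in>V'. c q * const (s q) = c' q * const (s q)" and q: "q \<in> V'"
      obtain f f' where f: "c q = const (f q)" "c' q = const (f' q)"
        using c q unfolding secs_structure_sheaf by blast
      have "const (f q * s q) = const (f' q * s q)"
        using eq q unfolding const_mult f[symmetric] by blast
      moreover have "s q \<noteq> 0" using q V'(2) s_nz by blast
      ultimately show "c q = c' q" unfolding f const_eq_iff by simp
    qed
  qed
  show "\<exists>V\<in>opens G. p \<in> V \<and> (\<exists>s. \<forall>V'\<in>opens G. V' \<subseteq> V \<longrightarrow>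
      (\<forall>\<Phi>. \<Phi> \<in> secs (L_sheaf G (sigma_prod k)) V' \<longleftrightarrow> (\<exists>c\<in>secs (structure_sheaf G) V'. \<forall>q\<in>V'. \<Phi> q = c q * s q)) \<and>
      (\<forall>c\<in>secs (structure_sheaf G) V'. \<forall>c'\<in>secs (structure_sheaf G) V'.
         (\<forall>q\<in>V'. c q * s q = c' q * s q) \<longrightarrow> (\<forall>q\<in>V'. c q = c' q)))"
    using V pV main by (intro bexI[of _ V] conjI exI[of _ "\<lambda>q. const (s q)"]) auto
qed


section \<open>The Euler classes\<close>

lemma beta_pow_secs_ell: "(\<lambda>_. beta_pow k) \<in> secs (ell G (- 2 * k)) V"
proof -
  have "elliptic_cocycle G (- 2 * k) V (\<lambda>_ _ _. beta_pow k)"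
    unfolding elliptic_cocycle_def
    by (auto simp: poly_growth_const homogeneous_def beta_pow_def case_prod_unfold)
  then show ?thesis by (auto simp: ell_def)
qed

lemma beta_pow_const: "beta_pow k * const x = Poly_Mapping.single k x"
  by (simp add: beta_pow_def const_def mult_single)

lemma beta_div_single: "beta_div u (Poly_Mapping.single k x) = Poly_Mapping.single k (x * u powi (- k))"
  unfolding beta_div_def
  by (intro poly_mapping_eqI) (auto simp: lookup_mapp lookup_single when_def in_keys_iff)

text \<open>
  The class is the pure tensor of \<open>\<beta>\<^bsup>-n\<^esup>\<close> and the canonical section. Under a modular matrix \<open>\<beta>\<^bsup>-n\<^esup>\<close>
  contributes the \<open>n\<close>-th power of the denominator, which is the factor of \<open>omega\<close> of weight \<open>n\<close>.
\<close>

theorem Euler_class_global_section: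
  fixes G :: "('n::finite) lie_data"
  assumes G: "compatible k G"
  shows "(\<lambda>p. beta_pow (- int CARD('n)) * const (sigma_prod k p)) \<in>
    global_sections (tensor (ell G (2 * int CARD('n))) (L_sheaf G (sigma_prod k)))"
proof -
  define \<Phi> where "\<Phi> = (\<lambda>p :: 'n pt. beta_pow (- int CARD('n)) * const (sigma_prod k p))"
  have "sigma_prod k \<in> hol (atlas :: 'n pt set)"
    by (simp add: hol_def holomorphic_at_sigma_prod poly_growth_sigma_prod)
  moreover have "equivariant_on G (jacobi_factor k) atlas (sigma_prod k)"
    by (rule equivariant_onI) (simp_all only: sigma_prod_transform[OF _ mat_1_SL2Z] sigma_prod_weyl[OF G] atlas_iff fst_conv)
  ultimately have "(\<lambda>p. const (sigma_prod k p)) \<in> secs (A_sheaf G (sigma_prod k)) atlas"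
    unfolding secs_A_sheaf[OF G order_refl] by blast
  then have b: "(\<lambda>p. const (sigma_prod k p)) \<in> secs (L_sheaf G (sigma_prod k)) atlas"
    by (rule secs_L_sheaf_I)
  have a: "(\<lambda>_. beta_pow (- int CARD('n))) \<in> secs (ell G (2 * int CARD('n))) atlas"
    using beta_pow_secs_ell[of "- int CARD('n)" G] by simp
  have "\<Phi> \<in> secs (tensor (ell G (2 * int CARD('n))) (L_sheaf G (sigma_prod k))) atlas"
    unfolding \<Phi>_def by (rule secs_tensor_product[OF a b])
  moreover have "beta_div (denom \<gamma> (fst p)) (\<Phi> (jacobi_act (modular \<gamma>) p)) =
      const (factor (tensor (ell G (2 * int CARD('n))) (L_sheaf G (sigma_prod k))) \<gamma> p) * \<Phi> p"
    if \<gamma>: "\<gamma> \<in> SL2Z" and p: "p \<in> atlas" for \<gamma> p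
  proof -
    have "modular \<gamma> \<in> jacobi_group G"
      using G \<gamma> by (simp add: compatible_def jacobi_group_def)
    then have fac: "factor (tensor (ell G (2 * int CARD('n))) (L_sheaf G (sigma_prod k))) \<gamma> p =
        jacobi_factor k (modular \<gamma>) p * denom \<gamma> (fst p) ^ CARD('n)"
      using cocycle_of_eq[OF G _ p, of 0 0 \<gamma>]
      by (simp add: tensor_def ell_def L_sheaf_def A_sheaf_def omega_def automorphic_sheaf_def)
    have "\<Phi> (jacobi_act (modular \<gamma>) p) =
        Poly_Mapping.single (- int CARD('n)) (jacobi_factor k (modular \<gamma>) p * sigma_prod k p)"
      unfolding \<Phi>_def beta_pow_const sigma_prod_transform[OF p \<gamma>] ..
    moreover have "\<Phi> p = Poly_Mapping.single (- int CARD('n)) (sigma_prod k p)"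
      by (simp add: \<Phi>_def beta_pow_const)
    ultimately show ?thesis
      unfolding fac by (simp add: beta_div_single const_def mult_single mult_ac)
  qed
  ultimately show ?thesis by (simp add: global_sections_def \<Phi>_def)
qed

lemma compatible_spin_group: "compatible 0 spin_group"
  by (auto simp: compatible_def spin_group_def)

lemma compatible_unitary_group: "compatible k unitary_group"
  by (auto simp: compatible_def unitary_group_def)

lemma compatible_maximal_torus: "compatible k G \<Longrightarrow> compatible l (maximal_torus G)"
  by (auto simp: compatible_def maximal_torus_def)

theorem proposition6p8:
  shows
    "(automorphy_cocycle (spin_group :: ('n::finite) lie_data) (cocycle_of spin_group sigma_SO) \<and>
      transforms_by (spin_group :: 'n lie_data) (cocycle_of spin_group sigma_SO) sigma_SO \<and>
      locally_free_rank_one (maximal_torus (spin_group :: 'n lie_data))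
        (L_sheaf (maximal_torus spin_group) sigma_SO) \<and>
      Eu_Spin \<in> global_sections (tensor (ell (spin_group :: 'n lie_data) (2 * int CARD('n)))
                                          (L_sheaf spin_group sigma_SO))) \<and>
     (automorphy_cocycle (unitary_group :: 'n lie_data) (cocycle_of unitary_group sigma_U) \<and>
      transforms_by (unitary_group :: 'n lie_data) (cocycle_of unitary_group sigma_U) sigma_U \<and>
      locally_free_rank_one (unitary_group :: 'n lie_data) (L_sheaf unitary_group sigma_U) \<and>
      Eu_U \<in> global_sections (tensor (ell (unitary_group :: 'n lie_data) (2 * int CARD('n)))
                                       (L_sheaf unitary_group sigma_U)))"
proof (intro conjI)
  show "locally_free_rank_one (maximal_torus (spin_group :: 'n lie_data))
        (L_sheaf (maximal_torus spin_group) sigma_SO)"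
    unfolding sigma_SO_eq
    by (rule locally_free_L_sheaf[OF compatible_maximal_torus[OF compatible_spin_group]])
      (auto simp: maximal_torus_def)
  show "locally_free_rank_one (unitary_group :: 'n lie_data) (L_sheaf unitary_group sigma_U)"
    unfolding sigma_U_eq
    by (rule locally_free_L_sheaf[OF compatible_unitary_group]) (auto simp: unitary_group_def)
  show "Eu_Spin \<in> global_sections (tensor (ell (spin_group :: 'n lie_data) (2 * int CARD('n)))
                                          (L_sheaf spin_group sigma_SO))"
    unfolding Eu_Spin_def[abs_def] sigma_SO_eq by (rule Euler_class_global_section[OF compatible_spin_group])
  show "Eu_U \<in> global_sections (tensor (ell (unitary_group :: 'n lie_data) (2 * int CARD('n)))
                                          (L_sheaf unitary_group sigma_U))"
    unfolding Eu_U_def[abs_def] sigma_U_eq by (rule Euler_class_global_section[OF compatible_unitary_group])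
qed (simp_all only: sigma_SO_eq sigma_U_eq cocycle_of_sigma_prod[OF compatible_spin_group]
    cocycle_of_sigma_prod[OF compatible_unitary_group])

end
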